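(* Let $G(p)$ be a pointed Brauer tree consisting of a single rooted branch, whose edges are numbered according to the pointed edge numbering by the integers of an interval $[a,\dots,b]$, and let the root be numbered $c$, where $a\le c\le b$. Then the permutation $\sigma$ of $\{a,\dots,b\}$ resulting from Kozakai's algorithm has the form $$\sigma=\pi_L\,(c)\,\pi_R,$$ where $\pi_L$ is a permutation of $a,a+1,\dots,c-2,c-1$ and $\pi_R$ is a permutation of $c+1,c+2,\dots,b-1,b$ (and $(c)$ denotes that $c$ is fixed).
   Context: **Brauer trees.** A Brauer tree with $e$ edges is a finite tree with $e$ edges, embedded in the plane so that the cyclic ordering of the edges at each vertex is counterclockwise, together with a designated exceptional vertex $v_0$ (carrying a multiplicity $m\ge 1$, which plays no role in the combinatorics below). The Brauer star is the tree in which every edge is incident to $v_0$. The distance of a vertex is the number of edges on the path joining it to $v_0$. Each edge has a near end (closer to $v_0$) and a far end. A vertex $u\ne v_0$ has an entering edge, the last edge on the path from $v_0$ to $u$. If $u$ has other edges, its primary edge is the edge next after the entering edge in the counterclockwise order at $u$, and its coprimary edge is the edge immediately before the entering edge. A rooted branch is a branch at $v_0$; its edge incident to $v_0$ is its root. A branch is a leaf if it consists of its root only. **Pointing.** A sector $(i,j)$ at a vertex $u$ is a pair of edges such that $j$ is next after $i$ in the counterclockwise order at $u$ (if $u$ has only one edge $i$, the only sector is $(i,i)$). A pointing $p$ is the choice, for each non-exceptional vertex, of one sector at that vertex; this sector is said to contain the point of the vertex. A pointed Brauer tree $G(p)$ is a Brauer tree $G$ with a pointing $p$. The point at the root means the point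 at the far end of the root. **Pointed edge numbering.** A Green's walk is a counterclockwise circuit around the planar tree, starting at $v_0$ and keeping the tree on one's left; thus, on arriving at a vertex $u\neq v_0$ along its entering edge, one next meets the primary edge of $u$. During the walk the non-exceptional vertices are given consecutive numbers $a,a+1,\dots,b$ in the order in which the walk passes through the sectors containing their points, and each edge receives the number of its far end. A reversed Green's walk goes in the opposite direction. **Pointed mutations.** Let $i$ be an edge. The mutation $\mu_i^-$ centered at $i$ is defined as follows. For each end $u$ of $i$ having an edge other than $i$, let $k$ be the edge immediately preceding $i$ in the counterclockwise order at $u$, and let $x$ be the other vertex of $k$. Then $i$ is detached from $u$ and reattached at $x$, inserted immediately before $k$ in the counterclockwise order at $x$. If an end of $i$ has no edge other than $i$, that end is left unchanged. All edges keep their names. The points are carried along as follows. (1) At $u$, a point lying in one of the two sectors adjacent to $i$ lies, after removal of $i$, in the merged sector. (2) At $x$, if $g$ is the edge immediately preceding $k$ before the mutation and the point of $x$ lies in $(g,k)$, then after the mutation it lies in $(g,i)$ (if $k$ is the only edge at $x$, then $g=k$). (3) All other points stay in their sectors. The mutation $\mu_i^+$ is the mirror-image dual, using the edges immediately following $i$ instead of those immediately preceding it. **Kozakai's algorithm.** 1. Fix a rooted branch that is not a leaf as initial branch and make it the current branch. 2. If the point at the root of the current branch is not in the sector between the root and the primary edge, set $\epsilon=-$ and walk from the root along successive primary edges until reaching the first vertex whose point is met on this walk, that is, whose point lies in the sector between its entering edge and its primary edge, or which is the end of a leaf. If the point at the root is in the sector between the root and the primary edge, set $\epsilon=+$ and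 walk from the root along successive coprimary edges until reaching the first vertex whose point lies in the sector between its coprimary edge and its entering edge, or which is the end of a leaf. Let $i$ be the entering edge of the vertex reached, and perform the pointed mutation $\mu_i^{\epsilon}$. If the near end of $i$ was the far end of the root, so that the mutation creates two branches at $v_0$, the branch containing $i$ becomes the current branch. 3. Repeat Step 2 as long as the current branch is not a leaf. 4. When the current branch is a leaf, choose as new current branch one which is not a leaf and whose edges belong to the initial branch, and repeat Steps 2 and 3, until all edges from the initial branch are leaves at $v_0$. If the tree is not yet a Brauer star, return to Step 1 to choose a new initial branch. **The permutation.** The edges keep their numbers during the mutations. The edges at $v_0$ are read counterclockwise starting from the sector at $v_0$ just before the root of the initial branch (edges inserted next to an existing branch by mutations do not cross this starting place). If the edges of the final Brauer star read $s_a,s_{a+1},\dots,s_b$ in this order, then $\sigma(i)=s_i$. *)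

theory Defs
  imports "HOL-Combinatorics.Permutations"
begin

section \<open>Brauer trees\<close>

text \<open>The planar embedding is given by the rotation system \<open>nxt\<close>: for an edge \<open>i\<close> at a vertex
  \<open>u\<close>, \<open>nxt G u i\<close> is the edge following \<open>i\<close> in the counterclockwise order at \<open>u\<close>. For a tree
  every rotation system is planar. The values of \<open>nxt G u i\<close> for \<open>i\<close> not at \<open>u\<close>, and of \<open>ends G i\<close>
  for \<open>i\<close> not an edge, are irrelevant.\<close>

record ('v, 'e) brauer_tree =
  verts :: "'v set"
  edges :: "'e set"
  ends :: "'e \<Rightarrow> 'v set"
  nxt :: "'v \<Rightarrow> 'e \<Rightarrow> 'e"
  exc :: 'v
  mult :: nat

definition inc :: "('v, 'e) brauer_tree \<Rightarrow> 'v \<Rightarrow> 'e set" where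
  "inc G u = {i \<in> edges G. u \<in> ends G i}"

definition other :: "('v, 'e) brauer_tree \<Rightarrow> 'e \<Rightarrow> 'v \<Rightarrow> 'v" where
  "other G i u = the_elem (ends G i - {u})"

fun walk :: "('v, 'e) brauer_tree \<Rightarrow> 'v \<Rightarrow> 'e list \<Rightarrow> 'v \<Rightarrow> bool" where
  "walk G u [] v \<longleftrightarrow> u \<in> verts G \<and> u = v"
| "walk G u (i # is) v \<longleftrightarrow> i \<in> inc G u \<and> walk G (other G i u) is v"

fun walk_verts :: "('v, 'e) brauer_tree \<Rightarrow> 'v \<Rightarrow> 'e list \<Rightarrow> 'v list" where
  "walk_verts G u [] = [u]"
| "walk_verts G u (i # is) = u # walk_verts G (other G i u) is"

definition path :: "('v, 'e) brauer_tree \<Rightarrow> 'v \<Rightarrow> 'e list \<Rightarrow> 'v \<Rightarrow> bool" where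
  "path G u is v \<longleftrightarrow> walk G u is v \<and> distinct (walk_verts G u is)"

text \<open>A graph is a tree if any two vertices are joined by exactly one path; paths are lists of
  edges, so this excludes parallel edges. The last conjunct says that the edges at each vertex
  form a single cycle under \<open>nxt\<close>.\<close>

definition is_brauer_tree :: "('v, 'e) brauer_tree \<Rightarrow> bool" where
  "is_brauer_tree G \<longleftrightarrow>
     finite (verts G) \<and> finite (edges G) \<and> exc G \<in> verts G \<and> mult G \<ge> 1 \<and>
     (\<forall>i\<in>edges G. ends G i \<subseteq> verts G \<and> card (ends G i) = 2) \<and>
     (\<forall>u\<in>verts G. \<forall>v\<in>verts G. \<exists>!is. path G u is v) \<and>
     (\<forall>u\<in>verts G. bij_betw (nxt G u) (inc G u) (inc G u) \<and>
        (\<forall>i\<in>inc G u. \<forall>j\<in>inc G u. \<exists>n. (nxt G u ^^ n) i = j))"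

definition prv :: "('v, 'e) brauer_tree \<Rightarrow> 'v \<Rightarrow> 'e \<Rightarrow> 'e" where
  "prv G u i = (THE k. k \<in> inc G u \<and> nxt G u k = i)"

definition path_to :: "('v, 'e) brauer_tree \<Rightarrow> 'v \<Rightarrow> 'e list" where
  "path_to G u = (THE is. path G (exc G) is u)"

definition distance :: "('v, 'e) brauer_tree \<Rightarrow> 'v \<Rightarrow> nat" where
  "distance G u = length (path_to G u)"

definition near_end :: "('v, 'e) brauer_tree \<Rightarrow> 'e \<Rightarrow> 'v" where
  "near_end G i = (THE u. u \<in> ends G i \<and> distance G u < distance G (other G i u))"

definition far_end :: "('v, 'e) brauer_tree \<Rightarrow> 'e \<Rightarrow> 'v" where
  "far_end G i = (THE u. u \<in> ends G i \<and> distance G (other G i u) < distance G u)"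

definition entering :: "('v, 'e) brauer_tree \<Rightarrow> 'v \<Rightarrow> 'e" where
  "entering G u = last (path_to G u)"

definition primary :: "('v, 'e) brauer_tree \<Rightarrow> 'v \<Rightarrow> 'e" where
  "primary G u = nxt G u (entering G u)"

definition coprimary :: "('v, 'e) brauer_tree \<Rightarrow> 'v \<Rightarrow> 'e" where
  "coprimary G u = prv G u (entering G u)"

definition is_star :: "('v, 'e) brauer_tree \<Rightarrow> bool" where
  "is_star G \<longleftrightarrow> (\<forall>i\<in>edges G. exc G \<in> ends G i)"

text \<open>The edges of the rooted branch with root \<open>r\<close>, where \<open>r\<close> is an edge at \<open>exc G\<close>.\<close>

definition branch :: "('v, 'e) brauer_tree \<Rightarrow> 'e \<Rightarrow> 'e set" where
  "branch G r = {i \<in> edges G. hd (path_to G (far_end G i)) = r}"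

definition leaf_branch :: "('v, 'e) brauer_tree \<Rightarrow> 'e \<Rightarrow> bool" where
  "leaf_branch G r \<longleftrightarrow> r \<in> inc G (exc G) \<and> branch G r = {r}"


section \<open>Pointings and the pointed edge numbering\<close>

text \<open>The value of a pointing at the exceptional vertex is irrelevant.\<close>

type_synonym ('v, 'e) pointing = "'v \<Rightarrow> 'e \<times> 'e"

definition sectors :: "('v, 'e) brauer_tree \<Rightarrow> 'v \<Rightarrow> ('e \<times> 'e) set" where
  "sectors G u = {(i, j). i \<in> inc G u \<and> j = nxt G u i}"

definition is_pointing :: "('v, 'e) brauer_tree \<Rightarrow> ('v, 'e) pointing \<Rightarrow> bool" where
  "is_pointing G p \<longleftrightarrow> (\<forall>u\<in>verts G - {exc G}. p u \<in> sectors G u)"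

text \<open>In Green's walk, \<open>(u, i)\<close> means that the walk is about to leave \<open>u\<close> along \<open>i\<close>. Arriving along
  \<open>i\<close> at the other end \<open>w\<close>, it passes through the sector \<open>(i, nxt G w i)\<close> at \<open>w\<close>. The full circuit
  traverses each edge twice. The argument \<open>r\<close> is the edge at \<open>exc G\<close> with which the walk begins.\<close>

definition green_step :: "('v, 'e) brauer_tree \<Rightarrow> 'v \<times> 'e \<Rightarrow> 'v \<times> 'e" where
  "green_step G = (\<lambda>(u, i). let w = other G i u in (w, nxt G w i))"

definition green_sectors :: "('v, 'e) brauer_tree \<Rightarrow> 'e \<Rightarrow> ('v \<times> 'e \<times> 'e) list" where
  "green_sectors G r =
     map (\<lambda>n. let (u, i) = (green_step G ^^ n) (exc G, r); w = other G i u in (w, i, nxt G w i))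
       [0..<2 * card (edges G)]"

definition met_vertices :: "('v, 'e) brauer_tree \<Rightarrow> ('v, 'e) pointing \<Rightarrow> 'e \<Rightarrow> 'v list" where
  "met_vertices G p r =
     map fst (filter (\<lambda>(w, s). w \<noteq> exc G \<and> s = p w) (green_sectors G r))"

text \<open>Each edge gets the number of its far end. Conversely, the edge with far end \<open>u\<close> is the
  entering edge of \<open>u\<close>.\<close>

definition pointed_numbering ::
    "('v, 'e) brauer_tree \<Rightarrow> ('v, 'e) pointing \<Rightarrow> 'e \<Rightarrow> int \<Rightarrow> int \<Rightarrow> ('e \<Rightarrow> int) \<Rightarrow> bool" where
  "pointed_numbering G p r a b num \<longleftrightarrow>
     map num (map (entering G) (met_vertices G p r)) = [a..b]"


section \<open>Pointed mutations\<close>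

text \<open>\<open>slide_minus i u\<close> detaches the end \<open>u\<close> of \<open>i\<close> and reattaches it. In the merged sector
  \<open>(k, h)\<close> one has \<open>h = k\<close> if \<open>u\<close> has no edges other than \<open>i\<close> and \<open>k\<close>. Likewise \<open>g = k\<close> if \<open>k\<close> is
  the only edge at \<open>x\<close>.\<close>

definition slide_minus :: "'e \<Rightarrow> 'v \<Rightarrow> ('v, 'e) brauer_tree \<times> ('v, 'e) pointing \<Rightarrow>
    ('v, 'e) brauer_tree \<times> ('v, 'e) pointing" where
  "slide_minus i u = (\<lambda>(G, p).
     if inc G u = {i} then (G, p)
     else
       let k = prv G u i; h = nxt G u i; x = other G k u; g = prv G x k in
         (G\<lparr>ends := (ends G)(i := insert x (ends G i - {u})),
            nxt := (nxt G)(u := (nxt G u)(k := h), x := (nxt G x)(g := i, i := k))\<rparr>,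
          p(u := if p u \<in> {(k, i), (i, h)} then (k, h) else p u,
            x := if p x = (g, k) then (g, i) else p x)))"

definition slide_plus :: "'e \<Rightarrow> 'v \<Rightarrow> ('v, 'e) brauer_tree \<times> ('v, 'e) pointing \<Rightarrow>
    ('v, 'e) brauer_tree \<times> ('v, 'e) pointing" where
  "slide_plus i u = (\<lambda>(G, p).
     if inc G u = {i} then (G, p)
     else
       let k = nxt G u i; h = prv G u i; x = other G k u; g = nxt G x k in
         (G\<lparr>ends := (ends G)(i := insert x (ends G i - {u})),
            nxt := (nxt G)(u := (nxt G u)(h := k), x := (nxt G x)(k := i, i := g))\<rparr>,
          p(u := if p u \<in> {(h, i), (i, k)} then (h, k) else p u,
            x := if p x = (k, g) then (i, g) else p x)))"

text \<open>In a tree the two ends of \<open>i\<close> and the vertices to which they are reattached are four distinct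
  vertices, so the two slides do not interact and their order does not matter.\<close>

definition mu_minus :: "'e \<Rightarrow> ('v, 'e) brauer_tree \<times> ('v, 'e) pointing \<Rightarrow>
    ('v, 'e) brauer_tree \<times> ('v, 'e) pointing" where
  "mu_minus i = (\<lambda>(G, p). slide_minus i (far_end G i) (slide_minus i (near_end G i) (G, p)))"

definition mu_plus :: "'e \<Rightarrow> ('v, 'e) brauer_tree \<times> ('v, 'e) pointing \<Rightarrow>
    ('v, 'e) brauer_tree \<times> ('v, 'e) pointing" where
  "mu_plus i = (\<lambda>(G, p). slide_plus i (far_end G i) (slide_plus i (near_end G i) (G, p)))"


section \<open>Kozakai's algorithm\<close>

text \<open>The field \<open>start\<close> is the edge at the exceptional vertex that comes first after the starting
  place of the final reading.\<close>

record ('v, 'e) kstate =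
  tree :: "('v, 'e) brauer_tree"
  point :: "('v, 'e) pointing"
  initial :: "'e set"
  current :: 'e
  start :: 'e

definition first_from :: "('v \<Rightarrow> bool) \<Rightarrow> ('v \<Rightarrow> 'v) \<Rightarrow> 'v \<Rightarrow> 'v" where
  "first_from P f u = (f ^^ (LEAST n. P ((f ^^ n) u))) u"

definition minus_centre :: "('v, 'e) brauer_tree \<Rightarrow> ('v, 'e) pointing \<Rightarrow> 'e \<Rightarrow> 'e" where
  "minus_centre G p r = entering G
     (first_from (\<lambda>u. p u = (entering G u, primary G u) \<or> inc G u = {entering G u})
        (\<lambda>u. other G (primary G u) u) (far_end G r))"

definition plus_centre :: "('v, 'e) brauer_tree \<Rightarrow> ('v, 'e) pointing \<Rightarrow> 'e \<Rightarrow> 'e" where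
  "plus_centre G p r = entering G
     (first_from (\<lambda>u. p u = (coprimary G u, entering G u) \<or> inc G u = {entering G u})
        (\<lambda>u. other G (coprimary G u) u) (far_end G r))"

text \<open>If the near end of the centre \<open>i\<close> is the far end of the current root \<open>r\<close>, then \<open>i\<close>
  becomes a root: the mutation \<open>mu_minus\<close> inserts it immediately before \<open>r\<close> and on the same side of
  the starting place as \<open>r\<close>, hence it becomes the first edge if \<open>r\<close> was; \<open>mu_plus\<close> inserts it
  immediately after \<open>r\<close>, which does not change the first edge.\<close>

definition mutate :: "('v, 'e) kstate \<Rightarrow> ('v, 'e) kstate" where
  "mutate s =
     (let G = tree s; p = point s; r = current s; u = far_end G r in
      if p u \<noteq> (r, primary G u) then
        let i = minus_centre G p r; (G', p') = mu_minus i (G, p) in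
          s\<lparr>tree := G', point := p',
            current := (if near_end G i = u then i else r),
            start := (if near_end G i = u \<and> start s = r then i else start s)\<rparr>
      else
        let i = plus_centre G p r; (G', p') = mu_plus i (G, p) in
          s\<lparr>tree := G', point := p',
            current := (if near_end G i = u then i else r)\<rparr>)"

text \<open>The choices of the initial and of the current branch are left open, so the algorithm is a
  relation.\<close>

inductive kozakai_step :: "('v, 'e) kstate \<Rightarrow> ('v, 'e) kstate \<Rightarrow> bool" where
  mutate: "\<not> leaf_branch (tree s) (current s) \<Longrightarrow> kozakai_step s (mutate s)"
| choose_current:
    "\<lbrakk>leaf_branch (tree s) (current s);
      r \<in> inc (tree s) (exc (tree s)); \<not> leaf_branch (tree s) r;
      branch (tree s) r \<subseteq> initial s\<rbrakk>
     \<Longrightarrow> kozakai_step s (s\<lparr>current := r\<rparr>)"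
| choose_initial:
    "\<lbrakk>\<forall>i\<in>initial s. leaf_branch (tree s) i;
      r \<in> inc (tree s) (exc (tree s)); \<not> leaf_branch (tree s) r\<rbrakk>
     \<Longrightarrow> kozakai_step s (s\<lparr>initial := branch (tree s) r, current := r\<rparr>)"

text \<open>If the tree is a Brauer star from the beginning, no step is possible and \<open>r\<close> only fixes the
  starting place of the reading.\<close>

definition kozakai_start ::
    "('v, 'e) brauer_tree \<Rightarrow> ('v, 'e) pointing \<Rightarrow> ('v, 'e) kstate \<Rightarrow> bool" where
  "kozakai_start G p s \<longleftrightarrow>
     (\<exists>r\<in>inc G (exc G). (\<not> leaf_branch G r \<or> is_star G) \<and>
        s = \<lparr>tree = G, point = p, initial = branch G r, current = r, start = r\<rparr>)"

definition reading :: "('v, 'e) kstate \<Rightarrow> 'e list" where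
  "reading s =
     map (\<lambda>n. (nxt (tree s) (exc (tree s)) ^^ n) (start s)) [0..<card (edges (tree s))]"

definition kozakai_permutation ::
    "('v, 'e) brauer_tree \<Rightarrow> ('v, 'e) pointing \<Rightarrow> int \<Rightarrow> int \<Rightarrow> ('e \<Rightarrow> int) \<Rightarrow> (int \<Rightarrow> int) \<Rightarrow> bool"
  where
  "kozakai_permutation G p a b num \<sigma> \<longleftrightarrow>
     (\<exists>s t. kozakai_start G p s \<and> kozakai_step\<^sup>*\<^sup>* s t \<and> is_star (tree t) \<and>
        (\<forall>i. \<sigma> i = (if i \<in> {a..b} then num (reading t ! nat (i - a)) else i)))"

end

theory Submission
  imports Defs
begin

text \<open>
  Record a rooted branch as a planar tree in which the children of a vertex, listed from the primary
  edge to the coprimary edge, are cut by the point into a left and a right list. The pointed edge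
  numbering is then the in-order traversal. A pointed mutation consists of two slides. The slide at
  the near end lifts the leftmost subtree \<open>W\<close> without left children (rightmost without right
  children, for \<open>\<epsilon> = +\<close>) one level up, next to its parent, which does not change the in-order word of
  the forest at \<open>v\<^sub>0\<close>; the slide at the far end permutes the edges of \<open>W\<close> only. Since \<open>W\<close> is a proper
  initial (final) segment of its branch, not containing the root, the set of edges to the left of a
  fixed root and the set of edges to its right never change, and in the final star the in-order word
  is the reading. The sum of the distances decreases with every mutation, hence a star is reached.
\<close>

section \<open>Planar trees\<close>

text \<open>The lift is harmless because the walk follows first left children: the edge before the
  centre at its near end is the entering edge there, so the centre is moved to just before its own
  parent edge. The vertex it moves to, unless it is \<open>exc G\<close>, has that parent edge in
  its left list, hence its point is not in the sector that is cut by the insertion. The flip is less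
  harmless: it can exchange the centre with another edge in the word, and taken alone it can move
  vertices away from \<open>exc G\<close>. Therefore only the sets of edges on the two sides of the
  root are kept as an invariant, and the decrease of the distances is proved for both slides
  together. A further obstacle is that slides act on cyclic orders, whereas the reading needs a
  linear order of the branches from the starting place; a predicate on lists that is invariant under
  rotation links the two.\<close>

text \<open>In \<open>Node v e L R\<close> the edge \<open>e\<close> is the entering edge of \<open>v\<close>.\<close>

datatype ('v, 'e) ptree =
  Node (vtx: 'v) (edg: 'e) (lefts: "('v, 'e) ptree list") (rights: "('v, 'e) ptree list")

fun vlist :: "('v, 'e) ptree \<Rightarrow> 'v list" where
  "vlist (Node v e L R) = v # concat (map vlist (L @ R))"

fun inorder :: "('v, 'e) ptree \<Rightarrow> 'e list" where
  "inorder (Node v e L R) = concat (map inorder L) @ e # concat (map inorder R)"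

text \<open>A subtree does not know the near end of its entering edge, so each occurrence is stored
  together with that vertex. Occurrences then stand for the non-exceptional vertices and for the
  edges at once.\<close>

fun nlist :: "'v \<Rightarrow> ('v, 'e) ptree \<Rightarrow> ('v \<times> ('v, 'e) ptree) list" where
  "nlist x (Node v e L R) = (x, Node v e L R) # concat (map (nlist v) (L @ R))"

text \<open>The argument \<open>n\<close> is the distance of the top vertex, so
  \<open>weight 1\<close> of a branch at \<open>exc G\<close> is the sum of the distances of its
  vertices.\<close>

fun weight :: "nat \<Rightarrow> ('v, 'e) ptree \<Rightarrow> nat" where
  "weight n (Node v e L R) = n + sum_list (map (weight (Suc n)) (L @ R))"

fun mirror :: "('v, 'e) ptree \<Rightarrow> ('v, 'e) ptree" where
  "mirror (Node v e L R) = Node v e (rev (map mirror R)) (rev (map mirror L))"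

text \<open>To treat both signs at once, everything depends on a direction \<open>d\<close>: \<open>True\<close> is the
  counterclockwise order and belongs to \<open>mu_minus\<close>, and \<open>False\<close> is its mirror image, for which lists of
  edges are read clockwise and \<open>nxt\<close> moves backwards through them.\<close>

definition cyc :: "bool \<Rightarrow> ('e \<Rightarrow> 'e) \<Rightarrow> 'e list \<Rightarrow> bool" where
  "cyc d f es \<longleftrightarrow> distinct es \<and>
     (if d then map f es = rotate1 es else map f (rotate1 es) = es)"

definition orient :: "bool \<Rightarrow> 'a \<times> 'a \<Rightarrow> 'a \<times> 'a" where
  "orient d = (if d then id else prod.swap)"

text \<open>The pointed sector lies between the last left and the first right child. The entering
  edge \<open>e\<close> stands in for a missing one, so the end of a leaf gets the sector
  \<open>(e, e)\<close>.\<close>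

fun drawn :: "bool \<Rightarrow> ('v, 'e) brauer_tree \<Rightarrow> ('v, 'e) pointing \<Rightarrow> 'v \<Rightarrow> ('v, 'e) ptree \<Rightarrow> bool" where
  "drawn d G p x (Node v e L R) \<longleftrightarrow>
     ends G e = {x, v} \<and> cyc d (nxt G v) (e # map edg (L @ R)) \<and>
     p v = orient d (last (e # map edg L), hd (map edg R @ [e])) \<and>
     (\<forall>t\<in>set (L @ R). drawn d G p v t)"

definition forest_nodes :: "'v \<Rightarrow> ('v, 'e) ptree list \<Rightarrow> ('v \<times> ('v, 'e) ptree) list" where
  "forest_nodes x ts = concat (map (nlist x) ts)"

text \<open>\<open>ts\<close> lists the branches at \<open>exc G\<close>, read from the starting place.\<close>

locale realized =
  fixes d :: bool and G :: "('v, 'e) brauer_tree" and p :: "('v, 'e) pointing"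
    and ts :: "('v, 'e) ptree list"
  assumes verts_eq: "verts G = insert (exc G) (set (concat (map vlist ts)))"
    and edges_eq: "edges G = set (concat (map inorder ts))"
    and distinct_verts: "distinct (exc G # concat (map vlist ts))"
    and distinct_edges: "distinct (concat (map inorder ts))"
    and drawn: "\<forall>t\<in>set ts. drawn d G p (exc G) t"
    and cyc_exc: "cyc d (nxt G (exc G)) (map edg ts)"

lemma map_vtx_nlist: "map (\<lambda>n. vtx (snd n)) (nlist x t) = vlist t"
proof (induction x t rule: nlist.induct)
  case (1 x v e L R)
  have "map (\<lambda>n. vtx (snd n)) (concat (map (nlist v) ts)) = concat (map vlist ts)"
    if "set ts \<subseteq> set (L @ R)" for ts
    using that 1 by (induction ts) auto
  from this[of "L @ R"] show ?case by simp
qed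

lemma mset_concat_map_cong:
  assumes "\<And>x. x \<in> set xs \<Longrightarrow> mset (f x) = mset (g x)"
  shows "mset (concat (map f xs)) = mset (concat (map g xs))"
  using assms by (induction xs) auto

text \<open>Nodes are listed in preorder and the word is in-order, so only multisets can be
  compared; this suffices to carry over distinctness.\<close>

lemma mset_edg_nlist: "mset (map (\<lambda>n. edg (snd n)) (nlist x t)) = mset (inorder t)"
proof (induction x t rule: nlist.induct)
  case (1 x v e L R)
  have "mset (concat (map (\<lambda>t. map (\<lambda>n. edg (snd n)) (nlist v t)) (L @ R)))
      = mset (concat (map inorder (L @ R)))"
    by (rule mset_concat_map_cong) (use 1 in auto)
  then show ?case by (simp add: map_concat comp_def)
qed

lemma nlist_parent:
  "(v, t) \<in> set (nlist x s) \<Longrightarrow> (v = x \<and> t = s) \<or>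
     (\<exists>y e L R. (y, Node v e L R) \<in> set (nlist x s) \<and> t \<in> set (L @ R))"
proof (induction x s rule: nlist.induct)
  case (1 x w e L R)
  then show ?case by (auto; blast)
qed

lemma nlist_child:
  "(y, Node v e L R) \<in> set (nlist x s) \<Longrightarrow> t \<in> set (L @ R) \<Longrightarrow> (v, t) \<in> set (nlist x s)"
proof (induction x s rule: nlist.induct)
  case (1 x w f L' R')
  have self: "(v, t) \<in> set (nlist v t)" by (cases t) simp
  show ?case
  proof (cases "(y, Node v e L R) = (x, Node w f L' R')")
    case True
    with 1(2) self 1(3) show ?thesis by auto
  next
    case False
    with 1 show ?thesis by auto
  qed
qed

lemma nlist_self: "(x, t) \<in> set (nlist x t)"
  by (cases t) simp

lemma nlist_drawn: "(y, s) \<in> set (nlist x t) \<Longrightarrow> drawn d G p x t \<Longrightarrow> drawn d G p y s"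
  by (induction x t rule: nlist.induct) auto

lemma cyc_rotate1: "cyc d f (a # es) \<Longrightarrow> cyc d f (es @ [a])"
  unfolding cyc_def by (cases es) (auto split: if_splits)

lemma cyc_rotate: "cyc d f (as @ bs) \<longleftrightarrow> cyc d f (bs @ as)"
proof -
  have *: "cyc d f (as @ bs) \<Longrightarrow> cyc d f (bs @ as)" for as bs :: "'a list"
  proof (induction as arbitrary: bs)
    case (Cons a as)
    from cyc_rotate1[of d f a "as @ bs"] Cons.prems have "cyc d f (as @ (bs @ [a]))" by simp
    from Cons.IH[OF this] show ?case by simp
  qed simp
  show ?thesis using *[of as bs] *[of bs as] by blast
qed

section \<open>Vertices, edges and incidences of a realized forest\<close>

context realized
begin

abbreviation "occ \<equiv> set (forest_nodes (exc G) ts)"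

lemma distinct_nodes_vtx: "distinct (map (\<lambda>n. vtx (snd n)) (forest_nodes (exc G) ts))"
  using distinct_verts by (simp add: forest_nodes_def map_concat comp_def map_vtx_nlist)

lemma distinct_nodes_edg: "distinct (map (\<lambda>n. edg (snd n)) (forest_nodes (exc G) ts))"
proof -
  have "mset (concat (map (\<lambda>t. map (\<lambda>n. edg (snd n)) (nlist (exc G) t)) ts))
      = mset (concat (map inorder ts))"
    by (rule mset_concat_map_cong) (rule mset_edg_nlist)
  with distinct_edges show ?thesis
    by (metis (no_types, lifting) forest_nodes_def map_concat map_map comp_def mset_eq_imp_distinct_iff map_eq_conv)
qed

lemma occ_unique_vtx: "(x, t) \<in> occ \<Longrightarrow> (x', t') \<in> occ \<Longrightarrow> vtx t = vtx t' \<Longrightarrow> x = x' \<and> t = t'"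
  using distinct_nodes_vtx by (fastforce simp: distinct_map inj_on_def)

lemma occ_unique_edg: "(x, t) \<in> occ \<Longrightarrow> (x', t') \<in> occ \<Longrightarrow> edg t = edg t' \<Longrightarrow> x = x' \<and> t = t'"
  using distinct_nodes_edg by (fastforce simp: distinct_map inj_on_def)

lemma occ_root: "t \<in> set ts \<Longrightarrow> (exc G, t) \<in> occ"
  using nlist_self by (fastforce simp: forest_nodes_def)

lemma vtx_occ: "(\<lambda>n. vtx (snd n)) ` occ = set (concat (map vlist ts))"
proof -
  have "map (\<lambda>n. vtx (snd n)) (forest_nodes (exc G) ts) = concat (map vlist ts)"
    by (simp add: forest_nodes_def map_concat comp_def map_vtx_nlist)
  then show ?thesis by (metis list.set_map)
qed

lemma edg_occ: "(\<lambda>n. edg (snd n)) ` occ = edges G"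
proof -
  have "mset (concat (map (\<lambda>t. map (\<lambda>n. edg (snd n)) (nlist (exc G) t)) ts))
      = mset (concat (map inorder ts))"
    by (rule mset_concat_map_cong) (rule mset_edg_nlist)
  then have "set (concat (map (\<lambda>t. map (\<lambda>n. edg (snd n)) (nlist (exc G) t)) ts)) = edges G"
    unfolding edges_eq by (rule mset_eq_setD)
  then show ?thesis by (simp add: forest_nodes_def image_UN)
qed

lemma occ_vtx: "(x, t) \<in> occ \<Longrightarrow> vtx t \<in> verts G" "(x, t) \<in> occ \<Longrightarrow> vtx t \<noteq> exc G"
  using vtx_occ distinct_verts unfolding verts_eq by force+

lemma occ_edg: "(x, t) \<in> occ \<Longrightarrow> edg t \<in> edges G"
  using edg_occ by force

lemma vertE:
  assumes "v \<in> verts G" "v \<noteq> exc G"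
  obtains x t where "(x, t) \<in> occ" "vtx t = v"
proof -
  from assms have "v \<in> (\<lambda>n. vtx (snd n)) ` occ" unfolding vtx_occ verts_eq by auto
  with that show ?thesis by auto
qed

lemma edgeE:
  assumes "i \<in> edges G"
  obtains x t where "(x, t) \<in> occ" "edg t = i"
  using assms unfolding edg_occ[symmetric] by auto

lemma occ_drawn: "(x, t) \<in> occ \<Longrightarrow> drawn d G p x t"
  using drawn nlist_drawn by (fastforce simp: forest_nodes_def)

lemma occ_child:
  assumes "(x, Node v e L R) \<in> occ" "t \<in> set (L @ R)"
  shows "(v, t) \<in> occ"
proof -
  from assms(1) obtain s where "s \<in> set ts" "(x, Node v e L R) \<in> set (nlist (exc G) s)"
    by (auto simp: forest_nodes_def)
  with nlist_child[OF this(2) assms(2)] show ?thesis by (auto simp: forest_nodes_def)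
qed

lemma occ_parent:
  assumes "(x, t) \<in> occ"
  shows "(x = exc G \<and> t \<in> set ts) \<or> (\<exists>y e L R. (y, Node x e L R) \<in> occ \<and> t \<in> set (L @ R))"
proof -
  from assms obtain s where "s \<in> set ts" "(x, t) \<in> set (nlist (exc G) s)"
    by (auto simp: forest_nodes_def)
  with nlist_parent[OF this(2)] show ?thesis unfolding forest_nodes_def by fastforce
qed

lemma occ_exc: "(exc G, t) \<in> occ \<Longrightarrow> t \<in> set ts"
  using occ_parent occ_vtx(2) by (metis ptree.sel(1))

lemma occ_childD: "(v, t) \<in> occ \<Longrightarrow> (x, Node v e L R) \<in> occ \<Longrightarrow> t \<in> set (L @ R)"
  using occ_parent[of v t] occ_unique_vtx occ_vtx(2) by (metis ptree.sel(1) ptree.inject)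

lemma occ_parent_vert: "(x, t) \<in> occ \<Longrightarrow> x \<in> verts G"
  using occ_parent occ_vtx(1) unfolding verts_eq by (metis insertI1 ptree.sel(1))

lemma occ_ends: "(x, t) \<in> occ \<Longrightarrow> ends G (edg t) = {x, vtx t}"
  using occ_drawn by (cases t) force

text \<open>These are the paths from \<open>exc G\<close>, as \<open>down_path\<close> and
  \<open>path_down\<close> will show. The inductive form gives access to \<open>path_to\<close>,
  \<open>entering\<close> and \<open>distance\<close>, which rest on a definite description.\<close>

inductive down :: "'e list \<Rightarrow> 'v \<Rightarrow> bool" where
  down_exc: "down [] (exc G)"
| down_snoc: "down is x \<Longrightarrow> (x, t) \<in> occ \<Longrightarrow> down (is @ [edg t]) (vtx t)"

lemma down_unique: "down is v \<Longrightarrow> down js v \<Longrightarrow> is = js"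
proof (induction "is" v arbitrary: js rule: down.induct)
  case down_exc
  then show ?case by (cases rule: down.cases) (use occ_vtx in metis)+
next
  case (down_snoc "is" x t)
  from down_snoc.prems show ?case
  proof (cases rule: down.cases)
    case down_exc
    with down_snoc occ_vtx show ?thesis by metis
  next
    case (down_snoc js' x' t')
    with \<open>(x, t) \<in> occ\<close> have "x = x' \<and> t = t'" using occ_unique_vtx by metis
    with down_snoc down_snoc.IH show ?thesis by blast
  qed
qed

lemma down_exists_node:
  "(y, s) \<in> set (nlist x t) \<Longrightarrow> (x, t) \<in> occ \<Longrightarrow> down is x \<Longrightarrow> \<exists>js. down (is @ edg t # js) (vtx s)"
proof (induction x t arbitrary: "is" rule: nlist.induct)
  case (1 x v e L R)
  from down_snoc[OF 1(4,3)] have dn: "down (is @ [e]) v" by simp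
  show ?case
  proof (cases "(y, s) = (x, Node v e L R)")
    case True
    with dn show ?thesis by auto
  next
    case False
    with 1(2) obtain t where t: "t \<in> set (L @ R)" "(y, s) \<in> set (nlist v t)" by auto
    from 1(1)[OF t(1) t(2) occ_child[OF 1(3) t(1)] dn] show ?thesis by auto
  qed
qed

lemma other_eq:
  assumes "(x, t) \<in> occ"
  shows "other G (edg t) x = vtx t" "other G (edg t) (vtx t) = x" "x \<noteq> vtx t"
proof -
  show ne: "x \<noteq> vtx t"
  proof
    assume eq: "x = vtx t"
    \<comment> \<open>If the two ends coincided, \<open>t\<close> would be one of its own children,
      which its size excludes.\<close>
    obtain v e L R where t: "t = Node v e L R" by (cases t)
    with assms eq have "t \<in> set (L @ R)" using occ_childD by force
    then have "size t \<le> size_list size L \<or> size t \<le> size_list size R"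
      using size_list_estimation'[of t _ "size t" size] by auto
    then show False unfolding t by auto
  qed
  show "other G (edg t) x = vtx t" "other G (edg t) (vtx t) = x"
    unfolding other_def using occ_ends[OF assms] ne by (auto simp: the_elem_def)
qed

lemma inc_vtx:
  assumes "(x, Node v e L R) \<in> occ"
  shows "inc G v = set (e # map edg (L @ R))"
proof -
  have "i \<in> set (e # map edg (L @ R))" if "i \<in> inc G v" for i
  proof -
    from that have i: "i \<in> edges G" "v \<in> ends G i" by (auto simp: inc_def)
    from edgeE[OF i(1)] obtain y t where t: "(y, t) \<in> occ" "edg t = i" .
    with i occ_ends have "v = y \<or> v = vtx t" by blast
    then show ?thesis
    proof
      assume "v = y"
      with t occ_childD[OF _ assms] have "t \<in> set (L @ R)" by blast
      with t(2) show ?thesis by auto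
    next
      assume "v = vtx t"
      with occ_unique_vtx[OF t(1) assms] have "t = Node v e L R" by simp
      with t(2) show ?thesis by auto
    qed
  qed
  moreover have "e \<in> inc G v" using occ_ends[OF assms] occ_edg[OF assms] by (simp add: inc_def)
  moreover have "edg t \<in> inc G v" if "t \<in> set (L @ R)" for t
    using occ_child[OF assms that] occ_ends occ_edg unfolding inc_def by fastforce
  ultimately show ?thesis by auto
qed

lemma inc_exc: "inc G (exc G) = set (map edg ts)"
proof -
  have "i \<in> set (map edg ts)" if "i \<in> inc G (exc G)" for i
  proof -
    from that have i: "i \<in> edges G" "exc G \<in> ends G i" by (auto simp: inc_def)
    from edgeE[OF i(1)] obtain y t where t: "(y, t) \<in> occ" "edg t = i" .
    with i occ_ends[OF t(1)] occ_vtx(2)[OF t(1)] have "exc G = y" by auto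
    with t occ_exc show ?thesis by auto
  qed
  moreover have "edg t \<in> inc G (exc G)" if "t \<in> set ts" for t
    using occ_root[OF that] occ_ends occ_edg unfolding inc_def by fastforce
  ultimately show ?thesis by auto
qed

end

section \<open>Paths and ends in a drawn forest\<close>

text \<open>The edge listed after \<open>i\<close> in the direction \<open>d\<close>;
  \<open>turn (\<not> d)\<close> gives the one listed before it. At the entering edge it yields the
  primary edge for \<open>d = True\<close> and the coprimary edge for
  \<open>d = False\<close>.\<close>

definition turn :: "bool \<Rightarrow> ('v, 'e) brauer_tree \<Rightarrow> 'v \<Rightarrow> 'e \<Rightarrow> 'e" where
  "turn d G v i = (if d then nxt G v i else prv G v i)"

lemma cyc_inj_on: "cyc d f es \<Longrightarrow> inj_on f (set es)"
  unfolding cyc_def by (metis distinct_map set_rotate1 distinct1_rotate)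

lemma prv_eqI:
  assumes "inj_on (nxt G v) (inc G v)" "k \<in> inc G v" "nxt G v k = i"
  shows "prv G v i = k"
  unfolding prv_def using assms by (auto simp: inj_on_def)

lemma cyc_turn:
  assumes "cyc d (nxt G v) (k # es)" "inc G v = set (k # es)"
  shows "turn d G v k = hd (es @ [k])" "turn (\<not> d) G v k = last (k # es)"
proof -
  let ?f = "nxt G v"
  have inj: "inj_on ?f (inc G v)" using cyc_inj_on[OF assms(1)] assms(2) by simp
  have "turn d G v k = hd (es @ [k]) \<and> turn (\<not> d) G v k = last (k # es)"
  proof (cases d)
    case True
    with assms(1) have m: "map ?f (k # es) = es @ [k]" by (simp add: cyc_def)
    from m have "?f k = hd (es @ [k])" by (metis list.sel(1) list.simps(9))
    moreover from m have "?f (last (k # es)) = k"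
      by (metis last_map last_snoc list.distinct(1))
    then have "prv G v k = last (k # es)"
      using prv_eqI[OF inj] assms(2) last_in_set by (metis list.distinct(1))
    ultimately show ?thesis using True by (simp add: turn_def)
  next
    case False
    with assms(1) have m: "map ?f (es @ [k]) = k # es" by (simp add: cyc_def)
    from m have "?f k = last (k # es)"
      by (metis last_map last_snoc snoc_eq_iff_butlast)
    moreover from m have "?f (hd (es @ [k])) = k"
      by (metis hd_map list.sel(1) snoc_eq_iff_butlast)
    moreover have "hd (es @ [k]) \<in> inc G v" using assms(2) by (cases es) auto
    ultimately show ?thesis using False prv_eqI[OF inj] by (simp add: turn_def)
  qed
  then show "turn d G v k = hd (es @ [k])" "turn (\<not> d) G v k = last (k # es)" by auto
qed

lemma walk_end: "walk G u is v \<Longrightarrow> v \<in> verts G \<and> v \<in> set (walk_verts G u is)"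
  by (induction "is" arbitrary: u) auto

lemma walk_snoc:
  assumes "\<forall>i\<in>edges G. ends G i \<subseteq> verts G"
  shows "walk G u (is @ [i]) w \<longleftrightarrow>
    (\<exists>v. walk G u is v \<and> i \<in> inc G v \<and> w = other G i v \<and> w \<in> verts G)"
proof (induction "is" arbitrary: u)
  case Nil
  then show ?case using assms by (auto simp: inc_def)
qed auto

lemma walk_verts_snoc:
  "walk G u is v \<Longrightarrow> walk_verts G u (is @ [i]) = walk_verts G u is @ [other G i v]"
  by (induction "is" arbitrary: u) auto

lemma path_snoc:
  assumes "\<forall>i\<in>edges G. ends G i \<subseteq> verts G"
  shows "path G u (is @ [i]) w \<longleftrightarrow>
    (\<exists>v. path G u is v \<and> i \<in> inc G v \<and> w = other G i v \<and> w \<in> verts G \<and>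
      w \<notin> set (walk_verts G u is))"
  unfolding path_def walk_snoc[OF assms] by (auto simp: walk_verts_snoc)

lemma first_from_stop: "P u \<Longrightarrow> first_from P f u = u"
  unfolding first_from_def by (simp add: Least_eq_0)

text \<open>The second premise says that the search stops; without it \<open>LEAST\<close> has no
  specified value that could be shifted by one step.\<close>

lemma first_from_go:
  assumes "\<not> P u" "P ((f ^^ n) (f u))"
  shows "first_from P f u = first_from P f (f u)"
proof -
  have *: "(f ^^ n) (f u) = (f ^^ Suc n) u" for n by (simp add: funpow_swap1)
  have "(LEAST n. P ((f ^^ n) u)) = Suc (LEAST n. P ((f ^^ Suc n) u))"
    using Least_Suc[of "\<lambda>n. P ((f ^^ n) u)" "Suc n"] assms(2)[unfolded *] assms(1) by auto
  then show ?thesis unfolding first_from_def * by simp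
qed

context realized
begin

lemma ends_verts: "\<forall>i\<in>edges G. ends G i \<subseteq> verts G"
  using occ_ends occ_vtx(1) occ_parent_vert edgeE by (metis empty_subsetI insert_subset)

text \<open>The length bound keeps a descending walk from meeting a vertex twice: the next vertex
  has only one descending word, and it is longer than those of all vertices visited before.\<close>

lemma down_walk_verts:
  "down is v \<Longrightarrow> walk G (exc G) is v \<and>
     (\<forall>w\<in>set (walk_verts G (exc G) is). \<exists>js. down js w \<and> length js \<le> length is)"
proof (induction "is" v rule: down.induct)
  case down_exc
  then show ?case using down.down_exc verts_eq by auto
next
  case (down_snoc "is" x t)
  have inc: "edg t \<in> inc G x"
    using occ_ends[OF down_snoc(2)] occ_edg[OF down_snoc(2)] by (simp add: inc_def)
  show ?case
  proof (intro conjI ballI)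
    show "walk G (exc G) (is @ [edg t]) (vtx t)"
      using walk_snoc[OF ends_verts] inc down_snoc other_eq(1) occ_vtx(1) by metis
    fix w assume "w \<in> set (walk_verts G (exc G) (is @ [edg t]))"
    then have "w \<in> set (walk_verts G (exc G) is) \<or> w = vtx t"
      using walk_verts_snoc[of G "exc G" "is" x "edg t"] down_snoc other_eq(1) by auto
    then show "\<exists>js. down js w \<and> length js \<le> length (is @ [edg t])"
      using down_snoc down.down_snoc by fastforce
  qed
qed

lemma down_path: "down is v \<Longrightarrow> path G (exc G) is v"
proof (induction "is" v rule: down.induct)
  case down_exc
  then show ?case using verts_eq by (simp add: path_def)
next
  case (down_snoc "is" x t)
  have inc: "edg t \<in> inc G x"
    using occ_ends[OF down_snoc(2)] occ_edg[OF down_snoc(2)] by (simp add: inc_def)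
  have "vtx t \<notin> set (walk_verts G (exc G) is)"
  proof
    assume "vtx t \<in> set (walk_verts G (exc G) is)"
    with down_walk_verts[OF down_snoc(1)] obtain js where "down js (vtx t)" "length js \<le> length is"
      by auto
    with down_unique down.down_snoc[OF down_snoc(1,2)] show False by fastforce
  qed
  then show ?case
    using path_snoc[OF ends_verts] inc down_snoc other_eq(1) occ_vtx(1) by metis
qed

text \<open>Climbing from \<open>u\<close> would lead to the parent of \<open>u\<close>, which a
  descending path has just visited; so the last edge of a path descends as well.\<close>

lemma path_down: "path G (exc G) is v \<Longrightarrow> down is v"
proof (induction "is" arbitrary: v rule: rev_induct)
  case Nil
  then show ?case using down_exc by (simp add: path_def)
next
  case (snoc i "is")
  then obtain u where u: "path G (exc G) is u" "i \<in> inc G u" "v = other G i u"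
      "v \<notin> set (walk_verts G (exc G) is)"
    using path_snoc[OF ends_verts] by metis
  from snoc.IH[OF u(1)] have dn: "down is u" .
  from u(2) have i: "i \<in> edges G" "u \<in> ends G i" by (auto simp: inc_def)
  from edgeE[OF i(1)] obtain x t where t: "(x, t) \<in> occ" "edg t = i" .
  from i(2) occ_ends[OF t(1)] t(2) have "u = x \<or> u = vtx t" by auto
  then show ?case
  proof
    assume "u = x"
    with down_snoc[OF dn] t u(3) other_eq(1)[OF t(1)] show ?thesis by auto
  next
    assume ut: "u = vtx t"
    from dn show ?thesis
    proof (cases rule: down.cases)
      case down_exc
      with ut occ_vtx(2)[OF t(1)] show ?thesis by simp
    next
      case (down_snoc js y s)
      with ut t(1) have "y = x" "s = t" using occ_unique_vtx by metis+
      with down_snoc t u(3) ut other_eq(2)[OF t(1)] have "v = y" by auto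
      moreover from down_path[OF down_snoc(3)] have "y \<in> set (walk_verts G (exc G) js)"
        using walk_end unfolding path_def by metis
      moreover have "set (walk_verts G (exc G) js) \<subseteq> set (walk_verts G (exc G) is)"
        using walk_verts_snoc[of G _ js y] down_walk_verts[OF down_snoc(3)] down_snoc(1) by auto
      ultimately show ?thesis using u(4) by auto
    qed
  qed
qed

lemma path_to_down: "down is v \<Longrightarrow> path_to G v = is"
  unfolding path_to_def using down_path path_down down_unique by blast

lemma down_exists: "v \<in> verts G \<Longrightarrow> \<exists>is. down is v"
proof (cases "v = exc G")
  case True
  then show ?thesis using down_exc by blast
next
  assume "v \<in> verts G" "v \<noteq> exc G"
  then obtain x t where "(x, t) \<in> occ" "vtx t = v" using vertE by blast
  then show ?thesis unfolding forest_nodes_def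
    using down_exists_node[OF _ occ_root down_exc] by fastforce
qed

lemma path_to_exc: "path_to G (exc G) = []"
  using path_to_down[OF down_exc] .

lemma path_to_vtx:
  assumes "(x, t) \<in> occ"
  shows "path_to G (vtx t) = path_to G x @ [edg t]"
proof -
  from down_exists[OF occ_parent_vert[OF assms]] obtain "is" where dn: "down is x" by blast
  from path_to_down[OF this] path_to_down[OF down_snoc[OF dn assms]] show ?thesis by simp
qed

lemma entering_vtx: "(x, t) \<in> occ \<Longrightarrow> entering G (vtx t) = edg t"
  by (simp add: entering_def path_to_vtx)

lemma distance_vtx: "(x, t) \<in> occ \<Longrightarrow> distance G (vtx t) = Suc (distance G x)"
  by (simp add: distance_def path_to_vtx)

lemma far_end_edg: "(x, t) \<in> occ \<Longrightarrow> far_end G (edg t) = vtx t"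
  unfolding far_end_def
  by (rule the_equality) (auto simp: occ_ends other_eq distance_vtx)

lemma near_end_edg: "(x, t) \<in> occ \<Longrightarrow> near_end G (edg t) = x"
  unfolding near_end_def
  by (rule the_equality) (auto simp: occ_ends other_eq distance_vtx)

lemma cyc_vtx: "(x, Node v e L R) \<in> occ \<Longrightarrow> cyc d (nxt G v) (e # map edg (L @ R))"
  using occ_drawn by force

lemma point_vtx:
  "(x, Node v e L R) \<in> occ \<Longrightarrow> p v = orient d (last (e # map edg L), hd (map edg R @ [e]))"
  using occ_drawn by force

lemma hd_path_to:
  assumes "(y, s) \<in> set (nlist (exc G) t)" "t \<in> set ts"
  shows "hd (path_to G (vtx s)) = edg t"
proof -
  from down_exists_node[OF assms(1) occ_root[OF assms(2)] down_exc]
  obtain js where "down (edg t # js) (vtx s)" by auto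
  from path_to_down[OF this] show ?thesis by simp
qed

lemma leaf_branch_root:
  assumes "Node v e L R \<in> set ts"
  shows "leaf_branch G e \<longleftrightarrow> L = [] \<and> R = []"
proof -
  let ?t = "Node v e L R"
  have "e \<in> inc G (exc G)" using inc_exc assms by force
  have eq: "branch G e = edg ` snd ` set (nlist (exc G) ?t)"
  proof (intro equalityI subsetI)
    fix i assume "i \<in> branch G e"
    then have i: "i \<in> edges G" "hd (path_to G (far_end G i)) = e" by (auto simp: branch_def)
    from edgeE[OF i(1)] obtain x s where s: "(x, s) \<in> occ" "edg s = i" .
    then obtain t where t: "t \<in> set ts" "(x, s) \<in> set (nlist (exc G) t)"
      by (auto simp: forest_nodes_def)
    have "edg t = edg ?t" using hd_path_to[OF t(2,1)] far_end_edg[OF s(1)] s(2) i(2) by simp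
    then have "t = ?t" using occ_unique_edg occ_root t(1) assms by blast
    with t(2) s(2) show "i \<in> edg ` snd ` set (nlist (exc G) ?t)" by force
  next
    fix i assume "i \<in> edg ` snd ` set (nlist (exc G) ?t)"
    then obtain x s where s: "(x, s) \<in> set (nlist (exc G) ?t)" "i = edg s" by force
    then have "(x, s) \<in> occ" using assms by (auto simp: forest_nodes_def simp del: nlist.simps)
    with s hd_path_to[OF s(1) assms] show "i \<in> branch G e"
      by (simp add: branch_def occ_edg far_end_edg)
  qed
  show ?thesis
  proof
    assume "leaf_branch G e"
    then have br: "branch G e = {e}" by (simp add: leaf_branch_def)
    have False if "t \<in> set (L @ R)" for t
    proof -
      have "edg t \<in> branch G e" unfolding eq using that nlist_self[of v t] by force
      with br have "edg t = e" by simp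
      moreover have "edg t \<noteq> e" using cyc_vtx[OF occ_root[OF assms]] that by (auto simp: cyc_def)
      ultimately show False by simp
    qed
    then show "L = [] \<and> R = []" by (metis append_is_Nil_conv last_in_set)
  next
    assume "L = [] \<and> R = []"
    with eq \<open>e \<in> inc G (exc G)\<close> show "leaf_branch G e" by (simp add: leaf_branch_def)
  qed
qed

lemma is_star_leaves: "is_star G \<longleftrightarrow> (\<forall>t\<in>set ts. lefts t = [] \<and> rights t = [])"
proof
  assume star: "is_star G"
  show "\<forall>t\<in>set ts. lefts t = [] \<and> rights t = []"
  proof
    fix t assume t: "t \<in> set ts"
    obtain v e L R where teq: "t = Node v e L R" by (cases t)
    have False if "s \<in> set (L @ R)" for s
    proof -
      from occ_child[OF _ that] occ_root[OF t] have s: "(v, s) \<in> occ" unfolding teq .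
      then have "exc G \<in> ends G (edg s)" using star occ_edg unfolding is_star_def by blast
      then have "v = exc G" using occ_ends[OF s] occ_vtx(2)[OF s] by auto
      with occ_vtx(2)[OF occ_root[OF t]] teq show False by simp
    qed
    then have "L @ R = []" by (metis last_in_set)
    with teq show "lefts t = [] \<and> rights t = []" by simp
  qed
next
  assume leaves: "\<forall>t\<in>set ts. lefts t = [] \<and> rights t = []"
  show "is_star G" unfolding is_star_def
  proof
    fix i assume "i \<in> edges G"
    then obtain x s where s: "(x, s) \<in> occ" "edg s = i" using edgeE by blast
    then obtain t where t: "t \<in> set ts" "(x, s) \<in> set (nlist (exc G) t)"
      by (auto simp: forest_nodes_def)
    with leaves have "x = exc G" by (cases t) auto
    with occ_ends[OF s(1)] s(2) show "exc G \<in> ends G i" by auto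
  qed
qed

end

section \<open>Slides\<close>

definition slide :: "bool \<Rightarrow> 'e \<Rightarrow> 'v \<Rightarrow> ('v, 'e) brauer_tree \<times> ('v, 'e) pointing \<Rightarrow>
    ('v, 'e) brauer_tree \<times> ('v, 'e) pointing" where
  "slide d = (if d then slide_minus else slide_plus)"

text \<open>The effect of a slide from \<open>u\<close> along \<open>k\<close> to \<open>x\<close>,
  in a form common to both directions. \<open>A\<close> continues the cyclic list at
  \<open>u\<close> after \<open>k\<close> and \<open>i\<close>, and \<open>B\<close> the one at
  \<open>x\<close> after \<open>k\<close>. Hence \<open>hd (A @ [k])\<close> follows
  \<open>i\<close> and \<open>last (k # B)\<close> precedes \<open>k\<close>, also when the lists
  are empty.\<close>

definition slid :: "bool \<Rightarrow> ('v, 'e) brauer_tree \<Rightarrow> ('v, 'e) pointing \<Rightarrow> 'e \<Rightarrow> 'e \<Rightarrow> 'v \<Rightarrow> 'v \<Rightarrow>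
    'e list \<Rightarrow> 'e list \<Rightarrow> ('v, 'e) brauer_tree \<Rightarrow> ('v, 'e) pointing \<Rightarrow> bool" where
  "slid d G p i k u x A B G' p' \<longleftrightarrow>
     verts G' = verts G \<and> edges G' = edges G \<and> exc G' = exc G \<and>
     ends G' = (ends G)(i := insert x (ends G i - {u})) \<and>
     (\<forall>v. v \<noteq> u \<and> v \<noteq> x \<longrightarrow> nxt G' v = nxt G v \<and> p' v = p v) \<and>
     cyc d (nxt G' u) (k # A) \<and> cyc d (nxt G' x) (i # k # B) \<and>
     p' u = (if p u \<in> {orient d (k, i), orient d (i, hd (A @ [k]))}
             then orient d (k, hd (A @ [k])) else p u) \<and>
     p' x = (if p x = orient d (last (k # B), k) then orient d (last (k # B), i) else p x)"

text \<open>Removing \<open>i\<close> redirects one value of \<open>nxt\<close>: in counterclockwise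
  lists that of \<open>k\<close>, in clockwise lists that of the edge listed after
  \<open>i\<close>.\<close>

lemma cyc_remove_True:
  assumes "cyc True f (k # i # A)"
  shows "cyc True (f(k := hd (A @ [k]))) (k # A)"
  using assms unfolding cyc_def by (cases A) auto

lemma cyc_remove_False:
  assumes "cyc False f (k # i # A)"
  shows "cyc False (f(hd (A @ [k]) := k)) (k # A)"
  using assms unfolding cyc_def by (cases A) auto

lemma cyc_insert_True:
  assumes "cyc True f (k # B)" "i \<notin> set (k # B)"
  shows "cyc True (f(last (k # B) := i, i := k)) (i # k # B)"
proof (cases B rule: rev_cases)
  case Nil
  with assms show ?thesis by (simp add: cyc_def)
next
  case (snoc B' g)
  with assms(1) have "(f k # map f B') @ [f g] = (B' @ [g]) @ [k]" by (simp add: cyc_def)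
  then have "f k # map f B' = B' @ [g]" "f g = k" by (simp_all only: append1_eq_conv)
  then show ?thesis using snoc assms by (auto simp: cyc_def)
qed

lemma cyc_insert_False:
  assumes "cyc False f (k # B)" "i \<notin> set (k # B)"
  shows "cyc False (f(k := i, i := last (k # B))) (i # k # B)"
proof -
  from assms have m: "map f (B @ [k]) = k # B" by (simp add: cyc_def)
  then have "f k = last (k # B)"
    by (metis last_map last_snoc snoc_eq_iff_butlast)
  then have "map f B @ [last (k # B)] = k # B" using m by simp
  with assms show ?thesis by (auto simp: cyc_def)
qed

lemma slide_slid:
  assumes u: "cyc d (nxt G u) (k # i # A)" "inc G u = set (k # i # A)"
    and x: "cyc d (nxt G x) (k # B)" "inc G x = set (k # B)"
    and "other G k u = x" "u \<noteq> x" "i \<notin> inc G x"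
  shows "\<exists>G' p'. slide d i u (G, p) = (G', p') \<and> slid d G p i k u x A B G' p'"
proof -
  \<comment> \<open>Rotated so that \<open>i\<close> comes first, the list shows both neighbours of
    \<open>i\<close> to \<open>cyc_turn\<close>.\<close>
  have rot: "cyc d (nxt G u) (i # A @ [k])"
    using u(1) cyc_rotate[of d _ "[k]" "i # A"] by simp
  have inc_rot: "inc G u = set (i # A @ [k])" using u(2) by auto
  have h: "turn d G u i = hd (A @ [k])" and k: "turn (\<not> d) G u i = k"
    using cyc_turn[OF rot inc_rot] by (cases A; simp)+
  have g: "turn (\<not> d) G x k = last (k # B)"
    using cyc_turn[OF x] by simp
  have "k \<noteq> i" using u(1) by (simp add: cyc_def)
  then have not_leaf: "inc G u \<noteq> {i}" using u(2) by auto
  have ins: "i \<notin> set (k # B)" using assms by simp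
  show ?thesis
  proof (cases d)
    case True
    with h k g have "nxt G u i = hd (A @ [k])" "prv G u i = k" "prv G x k = last (k # B)"
      by (simp_all add: turn_def)
    moreover note True cyc_remove_True[of "nxt G u" k i A] cyc_insert_True[of "nxt G x" k B i]
    ultimately show ?thesis
      using assms ins not_leaf unfolding slid_def slide_def slide_minus_def
      by (auto simp: Let_def orient_def)
  next
    case False
    with h k g have "prv G u i = hd (A @ [k])" "nxt G u i = k" "nxt G x k = last (k # B)"
      by (simp_all add: turn_def)
    moreover note False cyc_remove_False[of "nxt G u" k i A] cyc_insert_False[of "nxt G x" k B i]
    ultimately show ?thesis
      using assms ins not_leaf unfolding slid_def slide_def slide_plus_def
      by (auto simp: Let_def orient_def)
  qed
qed

text \<open>Models the walk of the algorithm: the head of a non-empty left list is the next edge to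
  follow, and an empty left list means that the point is met or that the vertex is the end of a
  leaf.\<close>

fun leftmost :: "'v \<Rightarrow> ('v, 'e) ptree \<Rightarrow> 'v \<times> ('v, 'e) ptree" where
  "leftmost x (Node v e [] R) = (x, Node v e [] R)"
| "leftmost x (Node v e (t # L) R) = leftmost v t"

text \<open>The parent of the leftmost vertex, with its own parent \<open>x\<close> and with the edges at \<open>x\<close> that
  follow the edge between them in cyclic order; \<open>B\<close> is this list for the root.\<close>

fun above_leftmost :: "'v \<Rightarrow> 'e list \<Rightarrow> ('v, 'e) ptree \<Rightarrow> 'v \<times> 'e list \<times> ('v, 'e) ptree" where
  "above_leftmost x B (Node v e [] R) = (x, B, Node v e [] R)"
| "above_leftmost x B (Node v e (t # L) R) =
     (if lefts t = [] then (x, B, Node v e (t # L) R)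
      else above_leftmost v (map edg (L @ R) @ [e]) t)"

text \<open>The effects of the slides at the near end and at the far end of the centre.\<close>

fun lift :: "('v, 'e) ptree \<Rightarrow> ('v, 'e) ptree list" where
  "lift (Node v e [] R) = [Node v e [] R]"
| "lift (Node v e (t # L) R) =
     (if lefts t = [] then [t, Node v e L R] else [Node v e (lift t @ L) R])"

text \<open>Let \<open>L = []\<close> and let \<open>Y\<close> be the last right subtree. The edge
  \<open>i\<close> now ends at the vertex of \<open>Y\<close>, and the old vertex hangs there, on
  the edge of \<open>Y\<close>, as first left child. In the in-order word just these two edges
  change places.\<close>

fun flip_node :: "('v, 'e) ptree \<Rightarrow> ('v, 'e) ptree" where
  "flip_node (Node v i L R) =
     (if R = [] then Node v i L R
      else Node (vtx (last R)) i (Node v (edg (last R)) L (butlast R) # lefts (last R))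
             (rights (last R)))"

fun flip :: "('v, 'e) ptree \<Rightarrow> ('v, 'e) ptree" where
  "flip (Node v e [] R) = flip_node (Node v e [] R)"
| "flip (Node v e (t # L) R) = Node v e (flip t # L) R"

lemma edg_flip: "edg (flip t) = edg t"
  by (cases t rule: flip.cases) auto

lemma lefts_leftmost: "lefts (snd (leftmost x t)) = []"
  by (induction x t rule: leftmost.induct) auto

lemma leftmost_nlist: "leftmost x t \<in> set (nlist x t)"
  by (induction x t rule: leftmost.induct) auto

lemma leftmost_inorder: "\<exists>Q. inorder t = inorder (snd (leftmost x t)) @ Q"
  by (induction x t rule: leftmost.induct) auto

lemma leftmost_vlist: "set (vlist (snd (leftmost x t))) \<subseteq> set (vlist t)"
  by (induction x t rule: leftmost.induct) auto

lemma above_leftmostE: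
  assumes "lefts t \<noteq> []"
  obtains z C u e W L R where "above_leftmost x B t = (z, C, Node u e (W # L) R)"
    "leftmost x t = (u, W)" "lefts W = []"
proof -
  have "\<exists>z C u e W L R. above_leftmost x B t = (z, C, Node u e (W # L) R) \<and>
      leftmost x t = (u, W) \<and> lefts W = []"
    using assms
  proof (induction x B t rule: above_leftmost.induct)
    case (2 x B v e t L R)
    show ?case
    proof (cases "lefts t = []")
      case True
      then show ?thesis by (cases t) auto
    next
      case False
      with 2 show ?thesis by simp
    qed
  qed simp
  with that show ?thesis by blast
qed

text \<open>The slide at the near end touches the vertices \<open>u\<close> and \<open>z\<close>
  only. The first case, \<open>z = x\<close>, is the one in which a new branch splits off at
  \<open>exc G\<close>; in the second case both vertices are inside \<open>t\<close>.\<close>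

lemma above_leftmost_cases:
  assumes "lefts t \<noteq> []" "above_leftmost x B t = (z, C, Node u e (W # L) R)"
  shows "(lefts (hd (lefts t)) = [] \<and> z = x \<and> C = B \<and> t = Node u e (W # L) R) \<or>
    (lefts (hd (lefts t)) \<noteq> [] \<and> z \<in> set (vlist t))"
    "u \<in> set (vlist t)" "edg W \<in> set (inorder t)"
proof -
  have "((lefts (hd (lefts t)) = [] \<and> z = x \<and> C = B \<and> t = Node u e (W # L) R) \<or>
    (lefts (hd (lefts t)) \<noteq> [] \<and> z \<in> set (vlist t))) \<and> u \<in> set (vlist t) \<and> edg W \<in> set (inorder t)"
    using assms
  proof (induction x B t rule: above_leftmost.induct)
    case (2 x B v f t L' R')
    then show ?case by (cases W; cases t) (auto split: if_splits)
  qed simp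
  then show "(lefts (hd (lefts t)) = [] \<and> z = x \<and> C = B \<and> t = Node u e (W # L) R) \<or>
    (lefts (hd (lefts t)) \<noteq> [] \<and> z \<in> set (vlist t))"
    "u \<in> set (vlist t)" "edg W \<in> set (inorder t)" by auto
qed

lemma inorder_lift: "concat (map inorder (lift t)) = inorder t"
  by (induction t rule: lift.induct) auto

lemma mset_vlist_lift: "mset (concat (map vlist (lift t))) = mset (vlist t)"
  by (induction t rule: lift.induct) auto

lemma mset_flip_node: "lefts t = [] \<Longrightarrow> mset (vlist (flip_node t)) = mset (vlist t)"
    "lefts t = [] \<Longrightarrow> mset (inorder (flip_node t)) = mset (inorder t)"
proof -
  assume "lefts t = []"
  then obtain v i R where t: "t = Node v i [] R" by (cases t) auto
  have "mset (vlist (flip_node t)) = mset (vlist t) \<and> mset (inorder (flip_node t)) = mset (inorder t)"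
    unfolding t
  proof (cases R rule: rev_cases)
    case (snoc R' Y)
    then show "mset (vlist (flip_node (Node v i [] R))) = mset (vlist (Node v i [] R)) \<and>
      mset (inorder (flip_node (Node v i [] R))) = mset (inorder (Node v i [] R))"
      by (cases Y) auto
  qed auto
  then show "mset (vlist (flip_node t)) = mset (vlist t)"
    "mset (inorder (flip_node t)) = mset (inorder t)" by auto
qed

lemma mset_vlist_flip: "mset (vlist (flip t)) = mset (vlist t)"
proof (induction t rule: flip.induct)
  case (1 v e R)
  then show ?case using mset_flip_node(1)[of "Node v e [] R"] by simp
qed simp

lemma mset_inorder_flip: "mset (inorder (flip t)) = mset (inorder t)"
proof (induction t rule: flip.induct)
  case (1 v e R)
  then show ?case using mset_flip_node(2)[of "Node v e [] R"] by simp
qed simp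

text \<open>After the first slide the centre is still found by \<open>leftmost\<close>, now in the
  first tree, which is where the second slide acts.\<close>

lemma leftmost_lift: "snd (leftmost x (hd (lift t))) = snd (leftmost y t)"
proof (induction t arbitrary: x y rule: lift.induct)
  case (2 v e t L R)
  show ?case
  proof (cases "lefts t = []")
    case True
    then show ?thesis by (cases t) auto
  next
    case False
    then have "lift t \<noteq> []" by (cases t rule: lift.cases) auto
    then obtain a as where "lift t = a # as" by (cases "lift t") auto
    with 2[OF False, of v v] False show ?thesis by auto
  qed
qed simp

lemma drawn_cong:
  assumes "\<And>v. v \<in> set (vlist t) \<Longrightarrow> nxt G' v = nxt G v \<and> p' v = p v"
    and "\<And>i. i \<in> set (inorder t) \<Longrightarrow> ends G' i = ends G i"
  shows "drawn d G' p' x t = drawn d G p x t"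
  using assms
proof (induction t arbitrary: x)
  case (Node v e L R)
  have "drawn d G' p' v t = drawn d G p v t" if t: "t \<in> set (L @ R)" for t
  proof -
    from t consider "t \<in> set L" | "t \<in> set R" by auto
    then show ?thesis
      by cases (rule Node.IH; use Node.prems in auto)+
  qed
  with Node.prems show ?case by (auto simp del: append.simps)
qed

text \<open>A flip keeps the name of its top edge, so cyclic orders and points above
  \<open>W\<close> remain valid, and the induction descends to the flipped node.\<close>

lemma drawn_flip:
  assumes "drawn d G p x t" "leftmost x t = (z, W)" "distinct (vlist t)" "distinct (inorder t)"
    and "\<And>v. v \<in> set (vlist t) - set (vlist W) \<Longrightarrow> nxt G' v = nxt G v \<and> p' v = p v"
    and "\<And>i. i \<in> set (inorder t) - set (inorder W) \<Longrightarrow> ends G' i = ends G i"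
    and "drawn d G' p' z (flip_node W)"
  shows "drawn d G' p' x (flip t)"
  using assms
proof (induction x t rule: leftmost.induct)
  case (2 x v e t L R)
  from leftmost_vlist[of v t] 2(3) have V: "set (vlist W) \<subseteq> set (vlist t)" by simp
  from leftmost_inorder[of t v] 2(3) have E: "set (inorder W) \<subseteq> set (inorder t)" by auto
  have "drawn d G' p' v (flip t)"
    by (rule 2(1)) (use 2(2-8) in auto)
  moreover have "drawn d G' p' v s" if s: "s \<in> set (L @ R)" for s
  proof -
    from s V 2(4) have "set (vlist s) \<subseteq> set (vlist (Node v e (t # L) R)) - set (vlist W)" by auto
    moreover from s E 2(5)
    have "set (inorder s) \<subseteq> set (inorder (Node v e (t # L) R)) - set (inorder W)" by auto
    ultimately have "drawn d G' p' v s = drawn d G p v s"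
      using 2(6,7) by (intro drawn_cong) blast+
    then show ?thesis using 2(2) s by auto
  qed
  moreover have "v \<notin> set (vlist W)" "e \<notin> set (inorder W)" using 2(4,5) V E by auto
  ultimately show ?case using 2(2,6,7) by (auto simp: edg_flip)
next
  case (1 x v e R)
  then have "z = x" "W = Node v e [] R" by simp_all
  with 1(7) show ?case by simp
qed

lemma orient_eq: "orient d s = orient d s' \<longleftrightarrow> s = s'"
  by (cases s; cases s'; auto simp: orient_def)

lemma drawn_lift:
  assumes "drawn d G p x t" "distinct (x # vlist t)" "distinct (inorder t)" "lefts t \<noteq> []"
    and "above_leftmost x C t = (z, B, Node u e (W # L) R)" "lefts W = []"
    and "slid d G p (edg W) e u z (map edg (L @ R)) B G' p'"
  shows "\<forall>s\<in>set (lift t). drawn d G' p' x s"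
  using assms
proof (induction x C t rule: above_leftmost.induct)
  case (2 x C v f t L' R')
  note dr = 2(2) and dv = 2(3) and di = 2(4) and us = 2(6) and lW = 2(7) and sl = 2(8)
  show ?case
  proof (cases "lefts t = []")
    case True
    with us have eq: "z = x" "B = C" "u = v" "e = f" "W = t" "L = L'" "R = R'" by simp_all
    obtain w i RW where W: "t = Node w i [] RW" using lW by (cases t) (simp add: eq)
    have agree: "nxt G' y = nxt G y \<and> p' y = p y" if "y \<noteq> v" "y \<noteq> x" for y
      using sl that unfolding slid_def eq by blast
    have ends': "ends G' = (ends G)(i := insert x (ends G i - {v}))"
      using sl W unfolding slid_def eq by simp
    have sub: "drawn d G' p' y s = drawn d G p y s" if "s \<in> set (L' @ R') \<union> set RW" for s y
    proof (rule drawn_cong)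
      fix y assume "y \<in> set (vlist s)"
      with that dv W have "y \<noteq> v" "y \<noteq> x" by auto
      then show "nxt G' y = nxt G y \<and> p' y = p y" by (rule agree)
    next
      fix j assume "j \<in> set (inorder s)"
      with that di W have "j \<noteq> i" by auto
      then show "ends G' j = ends G j" using ends' by simp
    qed
    have wne: "w \<noteq> v" "w \<noteq> x" "v \<noteq> x" "f \<noteq> i" using dv di W by auto
    have "drawn d G' p' x t"
      using dr sub agree[OF wne(1,2)] ends' wne W by auto
    moreover have "drawn d G' p' x (Node v f L' R')"
    proof -
      have "ends G' f = {x, v}" using dr ends' wne by auto
      moreover have "cyc d (nxt G' v) (f # map edg (L' @ R'))"
        using sl unfolding slid_def eq by simp
      moreover have "p' v = orient d (last (f # map edg L'), hd (map edg R' @ [f]))"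
      proof -
        have pv: "p v = orient d (last (f # i # map edg L'), hd (map edg R' @ [f]))"
          using dr W by simp
        have cy: "distinct (f # i # map edg (L' @ R'))" using dr W by (simp add: cyc_def)
        have p'v: "p' v = (if p v \<in> {orient d (f, i), orient d (i, hd (map edg (L' @ R') @ [f]))}
             then orient d (f, hd (map edg (L' @ R') @ [f])) else p v)"
          using sl W unfolding slid_def eq by simp
        \<comment> \<open>Without further left children the point was in the sector following the
          lifted edge \<open>i\<close> and falls into the merged sector; otherwise it follows the
          last edge of \<open>L'\<close>, away from \<open>i\<close>.\<close>
        show ?thesis
        proof (cases "L' = []")
          case True
          with p'v pv show ?thesis by simp
        next
          case False
          then have "last (map edg L') \<in> edg ` set L'" by (metis last_in_set list.map_disc_iff list.set_map)
          with cy have "last (map edg L') \<noteq> f" "last (map edg L') \<noteq> i" by auto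
          with p'v pv False show ?thesis by (simp add: orient_eq)
        qed
      qed
      moreover have "\<forall>s\<in>set (L' @ R'). drawn d G' p' v s" using sub dr by auto
      ultimately show ?thesis by simp
    qed
    ultimately show ?thesis using True by simp
  next
    case False
    have us': "above_leftmost v (map edg (L' @ R') @ [f]) t = (z, B, Node u e (W # L) R)"
      using us False by simp
    have IH: "\<forall>s\<in>set (lift t). drawn d G' p' v s"
      using 2(1)[OF False _ _ _ False us' lW sl] dr dv di by simp
    note loc = above_leftmost_cases[OF False us']
    have ux: "u \<noteq> x" "u \<noteq> v" "z \<noteq> x" using loc(1,2) dv by auto
    have agree: "nxt G' y = nxt G y \<and> p' y = p y" if "y \<noteq> u" "y \<noteq> z" for y
      using sl that unfolding slid_def by blast
    have ends': "ends G' j = ends G j" if "j \<noteq> edg W" for j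
      using sl that unfolding slid_def by simp
    have fW: "f \<noteq> edg W" using loc(3) di by auto
    have sub: "drawn d G' p' y s = drawn d G p y s" if "s \<in> set (L' @ R')" for s y
    proof (rule drawn_cong)
      fix y assume "y \<in> set (vlist s)"
      with that dv loc(1,2) have "y \<noteq> u" "y \<noteq> z" by auto
      then show "nxt G' y = nxt G y \<and> p' y = p y" by (rule agree)
    next
      fix j assume "j \<in> set (inorder s)"
      with that di loc(3) have "j \<noteq> edg W" by auto
      then show "ends G' j = ends G j" by (rule ends')
    qed
    have pv: "p v = orient d (last (f # edg t # map edg L'), hd (map edg R' @ [f]))"
      using dr by simp
    have cy: "cyc d (nxt G v) (f # edg t # map edg (L' @ R'))" using dr by simp
    then have dist: "distinct (f # edg t # map edg (L' @ R'))" by (simp add: cyc_def)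
    have "cyc d (nxt G' v) (f # map edg ((lift t @ L') @ R')) \<and>
        p' v = orient d (last (f # map edg (lift t @ L')), hd (map edg R' @ [f]))"
      using loc(1)
    proof
      assume "lefts (hd (lefts t)) = [] \<and> z = v \<and> B = map edg (L' @ R') @ [f] \<and>
         t = Node u e (W # L) R"
      then have eq: "lefts W = []" "z = v" "B = map edg (L' @ R') @ [f]" "t = Node u e (W # L) R"
        using lW by simp_all
      then have lt: "map edg (lift t) = [edg W, e]" by simp
      have "cyc d (nxt G' v) ((edg W # e # map edg (L' @ R')) @ [f])"
        using sl eq unfolding slid_def by simp
      then have 1: "cyc d (nxt G' v) (f # map edg ((lift t @ L') @ R'))"
        unfolding cyc_rotate[of d _ _ "[f]"] using lt by simp
      have "f \<notin> set (edg t # map edg L')" using dist by auto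
      moreover have "last (edg t # map edg L') \<in> set (edg t # map edg L')"
        by (rule last_in_set) simp
      ultimately have "last (edg t # map edg L') \<noteq> f" by metis
      \<comment> \<open>As \<open>B\<close> ends in \<open>f\<close>, this is the sector between the
        entering edge \<open>f\<close> and the edge \<open>e\<close> of \<open>t\<close>; the point
        is not there because \<open>t\<close> is a left child.\<close>
      then have "p v \<noteq> orient d (last (e # B), e)" using pv eq by (auto simp: orient_eq)
      then have "p' v = p v" using sl eq unfolding slid_def by simp
      with pv lt eq 1 show ?thesis by simp
    next
      assume "lefts (hd (lefts t)) \<noteq> [] \<and> z \<in> set (vlist t)"
      then have *: "lefts (hd (lefts t)) \<noteq> []" "z \<noteq> v" using dv by auto
      then have "map edg (lift t) = [edg t]" using False by (cases t rule: lift.cases) auto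
      with cy pv agree[of v] ux * show ?thesis by simp
    qed
    with dr IH sub ends'[OF fW] False show ?thesis by auto
  qed
qed simp

lemma distinct_leftmost: "distinct (vlist t) \<Longrightarrow> distinct (vlist (snd (leftmost x t)))"
  by (induction x t rule: leftmost.induct) auto

context realized
begin

lemma above_leftmost_cyc:
  assumes "(x, t) \<in> occ" "lefts t \<noteq> []"
    and "cyc d (nxt G x) (edg t # B)" "inc G x = set (edg t # B)"
    and "above_leftmost x B t = (z, C, U)"
  shows "(z, U) \<in> occ \<and> cyc d (nxt G z) (edg U # C) \<and> inc G z = set (edg U # C)"
  using assms
proof (induction x B t rule: above_leftmost.induct)
  case (2 x B v e t L R)
  show ?case
  proof (cases "lefts t = []")
    case True
    with 2(6) have "z = x" "C = B" "U = Node v e (t # L) R" by simp_all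
    with 2(2,4,5) show ?thesis by blast
  next
    case False
    have "(v, t) \<in> occ" by (rule occ_child[OF 2(2)]) simp
    moreover have "cyc d (nxt G v) (edg t # map edg (L @ R) @ [e])"
      using cyc_vtx[OF 2(2)] cyc_rotate1[of d "nxt G v" e "edg t # map edg (L @ R)"] by simp
    moreover have "inc G v = set (edg t # map edg (L @ R) @ [e])"
      using inc_vtx[OF 2(2)] by auto
    ultimately show ?thesis using 2(1)[OF False] 2(6) False by simp
  qed
qed simp

lemma realized_lift:
  assumes ts: "ts = A @ t # B" and "lefts t \<noteq> []" and "leftmost (exc G) t = (u, W)"
  shows "\<exists>G' p'. slide d (edg W) u (G, p) = (G', p') \<and> exc G' = exc G \<and>
    realized d G' p' (A @ lift t @ B)"
proof -
  \<comment> \<open>The edges that follow the root of \<open>t\<close> in the cyclic order at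
    \<open>exc G\<close>: it runs through \<open>B\<close> and wraps round to
    \<open>A\<close>.\<close>
  let ?C = "map edg (B @ A)"
  have t: "t \<in> set ts" using ts by simp
  note tocc = occ_root[OF t]
  have rot: "cyc d (nxt G (exc G)) (edg t # ?C)"
    using cyc_exc unfolding ts using cyc_rotate[of d _ "map edg A" "edg t # map edg B"] by simp
  have inc_rot: "inc G (exc G) = set (edg t # ?C)" using inc_exc unfolding ts by auto
  from above_leftmostE[OF assms(2)] obtain z D u' e W' L R where
    us: "above_leftmost (exc G) ?C t = (z, D, Node u' e (W' # L) R)"
      and sp: "leftmost (exc G) t = (u', W')" and lW': "lefts W' = []" .
  from sp assms(3) have eq: "u' = u" "W' = W" by simp_all
  note us = us[unfolded eq] and lW = lW'[unfolded eq]
  let ?U = "Node u e (W # L) R"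
  from above_leftmost_cyc[OF tocc assms(2) rot inc_rot us]
  have z: "(z, ?U) \<in> occ" "cyc d (nxt G z) (e # D)" "inc G z = set (e # D)" by simp_all
  have W: "(u, W) \<in> occ" by (rule occ_child[OF z(1)]) simp
  have uz: "u \<noteq> z" "other G e u = z" using other_eq[OF z(1)] by simp_all
  \<comment> \<open>Two levels lie between them. So the centre is not yet attached at
    \<open>z\<close>, as \<open>slide_slid\<close> demands.\<close>
  have "z \<noteq> vtx W"
    using distance_vtx[OF z(1)] distance_vtx[OF W] by auto
  then have "edg W \<notin> inc G z" using occ_ends[OF W] uz by (simp add: inc_def)
  with slide_slid[of d G u e "edg W" "map edg (L @ R)" z D p]
  obtain G' p' where sl: "slide d (edg W) u (G, p) = (G', p')"
      and slid: "slid d G p (edg W) e u z (map edg (L @ R)) D G' p'"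
    using cyc_vtx[OF z(1)] inc_vtx[OF z(1)] z(2,3) uz by auto
  note loc = above_leftmost_cases[OF assms(2) us]
  have dv: "distinct (exc G # concat (map vlist ts))" using distinct_verts .
  have dt: "distinct (exc G # vlist t)" "distinct (inorder t)"
    using dv distinct_edges unfolding ts by auto
  have G': "verts G' = verts G" "edges G' = edges G" "exc G' = exc G"
    using slid by (simp_all add: slid_def)
  have zin: "z = exc G \<or> z \<in> set (vlist t)" using loc(1) by blast
  have agree: "drawn d G' p' (exc G) s" if s: "s \<in> set (A @ B)" for s
  proof -
    have "drawn d G' p' (exc G) s = drawn d G p (exc G) s"
    proof (rule drawn_cong)
      fix y assume "y \<in> set (vlist s)"
      with s dv zin loc(2) have "y \<noteq> u" "y \<noteq> z" unfolding ts by auto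
      then show "nxt G' y = nxt G y \<and> p' y = p y" using slid unfolding slid_def by blast
    next
      fix j assume "j \<in> set (inorder s)"
      with s distinct_edges loc(3) have "j \<noteq> edg W" unfolding ts by auto
      then show "ends G' j = ends G j" using slid by (simp add: slid_def)
    qed
    then show ?thesis using drawn s unfolding ts by auto
  qed
  have mv: "mset (concat (map vlist (A @ lift t @ B))) = mset (concat (map vlist ts))"
    unfolding ts by (simp add: mset_vlist_lift)
  have me: "concat (map inorder (A @ lift t @ B)) = concat (map inorder ts)"
    unfolding ts by (simp add: inorder_lift)
  have "realized d G' p' (A @ lift t @ B)"
  proof
    show "verts G' = insert (exc G') (set (concat (map vlist (A @ lift t @ B))))"
      using verts_eq G' mset_eq_setD[OF mv] by simp
    show "edges G' = set (concat (map inorder (A @ lift t @ B)))"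
      unfolding me G' edges_eq ..
    show "distinct (exc G' # concat (map vlist (A @ lift t @ B)))"
      using dv G' mset_eq_setD[OF mv] mset_eq_imp_distinct_iff[OF mv] by simp
    show "distinct (concat (map inorder (A @ lift t @ B)))"
      unfolding me by (rule distinct_edges)
    show "\<forall>s\<in>set (A @ lift t @ B). drawn d G' p' (exc G') s"
      using agree drawn_lift[OF _ dt assms(2) us lW slid] occ_drawn[OF tocc] G' by auto
    show "cyc d (nxt G' (exc G')) (map edg (A @ lift t @ B))"
      using loc(1)
    proof
      assume "lefts (hd (lefts t)) = [] \<and> z = exc G \<and> D = ?C \<and> t = ?U"
      then have *: "z = exc G" "D = ?C" "map edg (lift t) = [edg W, e]" using lW by auto
      \<comment> \<open>The slide yields the order beginning with the inserted edge; rotating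
        \<open>A\<close> back to the front keeps the new branch on the same side of the starting
        place as \<open>t\<close>.\<close>
      then have "cyc d (nxt G' (exc G)) ([edg W, e] @ map edg B @ map edg A)"
        using slid by (simp add: slid_def)
      then show ?thesis using cyc_rotate[of d _ "map edg A" "[edg W, e] @ map edg B"] * G' by simp
    next
      assume *: "lefts (hd (lefts t)) \<noteq> [] \<and> z \<in> set (vlist t)"
      then have "map edg (lift t) = [edg t]" using assms(2) by (cases t rule: lift.cases) auto
      moreover have "z \<noteq> exc G" "u \<noteq> exc G" using * loc(2) dt by auto
      then have "nxt G' (exc G) = nxt G (exc G)" using slid unfolding slid_def by metis
      ultimately show ?thesis using cyc_exc G' unfolding ts by simp
    qed
  qed
  with sl G' show ?thesis by blast
qed

lemma realized_flip:
  assumes ts: "ts = A @ t # B" and "leftmost (exc G) t = (x, W)"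
  shows "\<exists>G' p'. slide d (edg W) (vtx W) (G, p) = (G', p') \<and> exc G' = exc G \<and>
    realized d G' p' (A @ flip t # B)"
proof -
  have t: "t \<in> set ts" using ts by simp
  obtain w i RW where Weq: "W = Node w i [] RW"
    using lefts_leftmost[of "exc G" t] assms(2) by (cases W) auto
  have Wocc: "(x, W) \<in> occ"
    using leftmost_nlist[of "exc G" t] assms(2) t by (auto simp: forest_nodes_def)
  have dv: "distinct (exc G # concat (map vlist ts))" using distinct_verts .
  have dt: "distinct (exc G # vlist t)" "distinct (inorder t)"
    using dv distinct_edges unfolding ts by auto
  obtain G' p' where sl: "slide d i w (G, p) = (G', p')"
    and G': "verts G' = verts G" "edges G' = edges G" "exc G' = exc G"
    and frame: "\<And>v. v \<notin> set (vlist W) \<Longrightarrow> nxt G' v = nxt G v \<and> p' v = p v"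
        "\<And>j. j \<noteq> i \<Longrightarrow> ends G' j = ends G j"
    and flipped: "drawn d G' p' x (flip_node W)"
  proof (cases RW rule: rev_cases)
    case Nil
    have inc: "inc G w = {i}" using inc_vtx[OF Wocc[unfolded Weq]] Nil by simp
    then have "slide d i w (G, p) = (G, p)"
      by (simp add: slide_def slide_minus_def slide_plus_def)
    then show ?thesis
      by (rule that) (use Weq Nil occ_drawn[OF Wocc] in auto)
  next
    case (snoc R0 Y)
    obtain y k Ly Ry where Y: "Y = Node y k Ly Ry" by (cases Y)
    have Yocc: "(w, Node y k Ly Ry) \<in> occ" by (rule occ_child[OF Wocc[unfolded Weq]]) (simp add: snoc Y)
    have distW: "distinct (vlist W)" "distinct (inorder W)"
      using distinct_leftmost[of t "exc G"] dt(1) assms(2) leftmost_inorder[of t "exc G"] dt(2) by auto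
    have cyw: "cyc d (nxt G w) (k # i # map edg R0)"
      using cyc_vtx[OF Wocc[unfolded Weq]] cyc_rotate[of d _ "[k]" "i # map edg R0"] snoc Y by simp
    moreover have "inc G w = set (k # i # map edg R0)"
      using inc_vtx[OF Wocc[unfolded Weq]] snoc Y by auto
    moreover note cyc_vtx[OF Yocc] inc_vtx[OF Yocc]
    moreover have "other G k w = y" "w \<noteq> y" using other_eq[OF Yocc] by simp_all
    moreover have "x \<noteq> w" using other_eq(3)[OF Wocc] Weq by simp
    moreover have "x \<noteq> y" using distance_vtx[OF Wocc] distance_vtx[OF Yocc] Weq by auto
    moreover have "i \<notin> inc G y"
      using occ_ends[OF Wocc] \<open>x \<noteq> y\<close> \<open>w \<noteq> y\<close> Weq by (simp add: inc_def)
    ultimately obtain G' p' where sl: "slide d i w (G, p) = (G', p')"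
      and slid: "slid d G p i k w y (map edg R0) (map edg (Ly @ Ry)) G' p'"
      using slide_slid[of d G w k i "map edg R0" y "map edg (Ly @ Ry)" p] by auto
    have agree: "nxt G' v = nxt G v \<and> p' v = p v" if "v \<noteq> w" "v \<noteq> y" for v
      using slid that unfolding slid_def by blast
    have ends': "ends G' = (ends G)(i := insert y (ends G i - {w}))"
      using slid by (simp add: slid_def)
    have endsi: "ends G' i = {x, y}"
      using ends' occ_ends[OF Wocc] \<open>x \<noteq> w\<close> Weq by auto
    have sub: "drawn d G' p' v s"
      if s: "s \<in> set R0 \<union> set (Ly @ Ry)" "drawn d G p v s" for s v
    proof -
      have "drawn d G' p' v s = drawn d G p v s"
      proof (rule drawn_cong)
        fix v assume "v \<in> set (vlist s)"
        with s(1) distW(1) have "v \<noteq> w" "v \<noteq> y" unfolding Weq snoc Y by auto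
        then show "nxt G' v = nxt G v \<and> p' v = p v" by (rule agree)
      next
        fix j assume "j \<in> set (inorder s)"
        with s(1) distW(2) have "j \<noteq> i" unfolding Weq snoc Y by auto
        then show "ends G' j = ends G j" using ends' by simp
      qed
      with s(2) show ?thesis by simp
    qed
    have ki: "k \<noteq> i" using distW(2) unfolding Weq snoc Y by auto
    have "drawn d G' p' y (Node w k [] R0)"
    proof -
      \<comment> \<open>The left list of \<open>w\<close> is empty, so its point is next to
        \<open>i\<close> and passes to the merged sector, which now follows \<open>k\<close>, the
        new entering edge of \<open>w\<close>.\<close>
      have pw: "p w = orient d (i, hd (map edg R0 @ [k]))"
        using point_vtx[OF Wocc[unfolded Weq]] snoc Y by (cases R0) auto
      have "p' w = orient d (k, hd (map edg R0 @ [k]))"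
        using slid pw unfolding slid_def by simp
      moreover have "ends G' k = {y, w}" using ends' ki occ_ends[OF Yocc] by auto
      moreover have "cyc d (nxt G' w) (k # map edg R0)" using slid by (simp add: slid_def)
      moreover have "\<forall>s\<in>set R0. drawn d G' p' w s"
        using sub occ_drawn[OF occ_child[OF Wocc[unfolded Weq]]] snoc by auto
      ultimately show ?thesis by simp
    qed
    moreover have "p' y = orient d (last (i # k # map edg Ly), hd (map edg Ry @ [i]))"
    proof -
      have py: "p y = orient d (last (k # map edg Ly), hd (map edg Ry @ [k]))"
        using point_vtx[OF Yocc] .
      have p'y: "p' y = (if p y = orient d (last (k # map edg (Ly @ Ry)), k)
          then orient d (last (k # map edg (Ly @ Ry)), i) else p y)"
        using slid unfolding slid_def by simp
      \<comment> \<open>If \<open>Ry\<close> is empty, the point was just before \<open>k\<close>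
        and is carried to the sector before \<open>i\<close>, the new entering edge of
        \<open>y\<close>; otherwise its sector does not end at \<open>k\<close> and is kept.\<close>
      show ?thesis
      proof (cases Ry)
        case Nil
        with py p'y show ?thesis by simp
      next
        case (Cons s Ry')
        have "edg s \<noteq> k" using cyc_vtx[OF Yocc] Cons by (auto simp: cyc_def)
        with py p'y Cons show ?thesis by (simp add: orient_eq)
      qed
    qed
    moreover have "cyc d (nxt G' y) (i # k # map edg (Ly @ Ry))" using slid by (simp add: slid_def)
    moreover have "\<forall>s\<in>set (Ly @ Ry). drawn d G' p' y s"
      using sub occ_drawn[OF occ_child[OF Yocc]] by auto
    ultimately have fl: "drawn d G' p' x (flip_node W)"
      using endsi unfolding Weq snoc Y by auto
    show ?thesis
    proof (rule that[OF sl _ _ _ _ _ fl])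
      show "verts G' = verts G" "edges G' = edges G" "exc G' = exc G"
        using slid by (simp_all add: slid_def)
      show "nxt G' v = nxt G v \<and> p' v = p v" if "v \<notin> set (vlist W)" for v
        by (rule agree) (use that in \<open>auto simp: Weq snoc Y\<close>)
      show "ends G' j = ends G j" if "j \<noteq> i" for j using ends' that by simp
    qed
  qed
  have iW: "i \<in> set (inorder W)" using Weq by simp
  have vW: "set (vlist W) \<subseteq> set (vlist t)" using leftmost_vlist[of "exc G" t] assms(2) by simp
  have eW: "set (inorder W) \<subseteq> set (inorder t)" using leftmost_inorder[of t "exc G"] assms(2) by auto
  have agree: "drawn d G' p' (exc G) s" if s: "s \<in> set (A @ B)" for s
  proof -
    have "drawn d G' p' (exc G) s = drawn d G p (exc G) s"
    proof (rule drawn_cong)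
      fix y assume "y \<in> set (vlist s)"
      with s dv vW have "y \<notin> set (vlist W)" unfolding ts by auto
      then show "nxt G' y = nxt G y \<and> p' y = p y" by (rule frame)
    next
      fix j assume "j \<in> set (inorder s)"
      with s distinct_edges eW iW have "j \<noteq> i" unfolding ts by auto
      then show "ends G' j = ends G j" by (rule frame)
    qed
    then show ?thesis using drawn s unfolding ts by auto
  qed
  have mv: "mset (concat (map vlist (A @ flip t # B))) = mset (concat (map vlist ts))"
    unfolding ts by (simp add: mset_vlist_flip)
  have me: "mset (concat (map inorder (A @ flip t # B))) = mset (concat (map inorder ts))"
    unfolding ts by (simp add: mset_inorder_flip)
  have "realized d G' p' (A @ flip t # B)"
  proof
    show "verts G' = insert (exc G') (set (concat (map vlist (A @ flip t # B))))"
      using verts_eq G' mset_eq_setD[OF mv] by simp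
    show "edges G' = set (concat (map inorder (A @ flip t # B)))"
      unfolding G' edges_eq mset_eq_setD[OF me] ..
    show "distinct (exc G' # concat (map vlist (A @ flip t # B)))"
      using dv G' mset_eq_setD[OF mv] mset_eq_imp_distinct_iff[OF mv] by simp
    show "distinct (concat (map inorder (A @ flip t # B)))"
      using mset_eq_imp_distinct_iff[OF me] distinct_edges by blast
    have "drawn d G' p' (exc G) (flip t)"
    proof (rule drawn_flip[OF occ_drawn[OF occ_root[OF t]] assms(2) _ dt(2) _ _ flipped])
      show "distinct (vlist t)" using dt by simp
    next
      fix v assume "v \<in> set (vlist t) - set (vlist W)"
      then show "nxt G' v = nxt G v \<and> p' v = p v" using frame(1) by blast
    next
      fix j assume "j \<in> set (inorder t) - set (inorder W)"
      then show "ends G' j = ends G j" by (intro frame(2)) (use iW in auto)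
    qed
    with agree G' show "\<forall>s\<in>set (A @ flip t # B). drawn d G' p' (exc G') s" by auto
    have "exc G \<notin> set (vlist W)" using vW dt by auto
    then show "cyc d (nxt G' (exc G')) (map edg (A @ flip t # B))"
      using cyc_exc frame(1)[of "exc G"] G' unfolding ts by (simp add: edg_flip)
  qed
  with sl G' show ?thesis unfolding Weq by auto
qed

end

section \<open>Pointed mutations\<close>

text \<open>The centre is always in the first tree of \<open>lift t\<close>, either as its root or
  further down; so this is the tree to flip.\<close>

definition step :: "('v, 'e) ptree \<Rightarrow> ('v, 'e) ptree list" where
  "step t = flip (hd (lift t)) # tl (lift t)"

definition mutation :: "bool \<Rightarrow> 'e \<Rightarrow> ('v, 'e) brauer_tree \<times> ('v, 'e) pointing \<Rightarrow>
    ('v, 'e) brauer_tree \<times> ('v, 'e) pointing" where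
  "mutation d = (if d then mu_minus else mu_plus)"

lemma mutation_slide:
  "mutation d i (G, p) = slide d i (far_end G i) (slide d i (near_end G i) (G, p))"
  by (simp add: mutation_def slide_def mu_minus_def mu_plus_def)

lemma lift_not_Nil: "lift t \<noteq> []"
  by (cases t rule: lift.cases) auto

lemma step_Cons:
  "step (Node v e (t # L) R) =
     (if lefts t = [] then [flip_node t, Node v e L R] else [Node v e (step t @ L) R])"
proof (cases "lefts t = []")
  case True
  then show ?thesis by (cases t) (auto simp: step_def)
next
  case False
  obtain a as where "lift t = a # as" using lift_not_Nil by (metis list.exhaust)
  with False show ?thesis by (simp add: step_def)
qed

lemma realized_step:
  assumes "realized d G p (A @ t # B)" and "lefts t \<noteq> []"
  shows "\<exists>G' p'. mutation d (edg (snd (leftmost (exc G) t))) (G, p) = (G', p') \<and> exc G' = exc G \<and>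
    realized d G' p' (A @ step t @ B)"
proof -
  interpret realized d G p "A @ t # B" by fact
  obtain u W where W: "leftmost (exc G) t = (u, W)" by fastforce
  from realized_lift[OF refl assms(2) W] obtain G1 p1
    where 1: "slide d (edg W) u (G, p) = (G1, p1)" "exc G1 = exc G"
      "realized d G1 p1 (A @ lift t @ B)" by blast
  have eq: "lift t = hd (lift t) # tl (lift t)" using lift_not_Nil[of t] by simp
  obtain x where x: "leftmost (exc G) (hd (lift t)) = (x, W)"
    using leftmost_lift[of "exc G" t "exc G"] W by (cases "leftmost (exc G) (hd (lift t))") auto
  interpret r1: realized d G1 p1 "A @ lift t @ B" by fact
  have "A @ lift t @ B = A @ hd (lift t) # (tl (lift t) @ B)" using eq by simp
  from r1.realized_flip[OF this, unfolded 1(2), OF x] obtain G2 p2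
    where 2: "slide d (edg W) (vtx W) (G1, p1) = (G2, p2)" "exc G2 = exc G"
      "realized d G2 p2 (A @ flip (hd (lift t)) # tl (lift t) @ B)" by blast
  have "(u, W) \<in> occ"
    using leftmost_nlist[of "exc G" t] W by (auto simp: forest_nodes_def)
  then have "near_end G (edg W) = u" "far_end G (edg W) = vtx W"
    by (simp_all add: near_end_edg far_end_edg)
  with 1 2 W show ?thesis by (simp add: mutation_slide step_def)
qed

lemma weight_Suc: "weight n t < weight (Suc n) t"
proof (induction t arbitrary: n)
  case (Node v e L R)
  have *: "sum_list (map (weight (Suc n)) ts) \<le> sum_list (map (weight (Suc (Suc n))) ts)"
    if "set ts \<subseteq> set (L @ R)" for ts
  proof (rule sum_list_mono)
    fix s assume "s \<in> set ts"
    with that have "s \<in> set L \<or> s \<in> set R" by auto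
    then show "weight (Suc n) s \<le> weight (Suc (Suc n)) s" using Node less_imp_le by blast
  qed
  from *[of "L @ R"] show ?case by simp
qed

text \<open>Measured from before the lift, the old top vertex and its right subtrees except the last
  keep their distances, while the last one comes two levels closer. For a leaf the lift alone gains
  one.\<close>

lemma weight_flip_node: "lefts t = [] \<Longrightarrow> weight n (flip_node t) < weight (Suc n) t"
proof -
  assume "lefts t = []"
  then obtain v e R where t: "t = Node v e [] R" by (cases t) auto
  have mono: "sum_list (map (weight m) ts) \<le> sum_list (map (weight (Suc m)) ts)"
    for m and ts :: "('a, 'b) ptree list"
    by (rule sum_list_mono) (simp add: weight_Suc less_imp_le)
  show ?thesis
  proof (cases R rule: rev_cases)
    case Nil
    with t show ?thesis by simp
  next
    case (snoc R' Y)
    obtain y k Ly Ry where Y: "Y = Node y k Ly Ry" by (cases Y)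
    from mono[of "Suc n" Ly] mono[of "Suc (Suc n)" Ly] mono[of "Suc n" Ry] mono[of "Suc (Suc n)" Ry]
    show ?thesis unfolding t snoc Y by simp
  qed
qed

lemma weight_step: "lefts t \<noteq> [] \<Longrightarrow> sum_list (map (weight n) (step t)) < weight n t"
proof (induction t arbitrary: n rule: lift.induct)
  case (2 v e t L R)
  show ?case
  proof (cases "lefts t = []")
    case True
    then show ?thesis using weight_flip_node[OF True, of n] by (simp add: step_Cons)
  next
    case False
    with 2(1)[OF False False, of "Suc n"] show ?thesis by (simp add: step_Cons)
  qed
qed simp

text \<open>\<open>P\<close> is the word of the leftmost subtree. Equality of sets suffices for it,
  since the invariant does not see the order within a side.\<close>

lemma inorder_step:
  "lefts t \<noteq> [] \<Longrightarrow> \<exists>P P' Q. inorder t = P @ Q \<and> concat (map inorder (step t)) = P' @ Q \<and>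
     set P' = set P \<and> edg t \<in> set Q"
proof (induction t rule: lift.induct)
  case (2 v e t L R)
  show ?case
  proof (cases "lefts t = []")
    case True
    then have "set (inorder (flip_node t)) = set (inorder t)"
      using mset_flip_node(2) mset_eq_setD by blast
    then show ?thesis using True
      by (intro exI[of _ "inorder t"] exI[of _ "inorder (flip_node t)"]
          exI[of _ "concat (map inorder L) @ e # concat (map inorder R)"]) (simp add: step_Cons)
  next
    case False
    from 2(1)[OF False False] obtain P P' Q where "inorder t = P @ Q"
      "concat (map inorder (step t)) = P' @ Q" "set P' = set P" by blast
    then show ?thesis using False
      by (intro exI[of _ P] exI[of _ P']
          exI[of _ "Q @ concat (map inorder L) @ e # concat (map inorder R)"]) (simp add: step_Cons)
  qed
qed simp

lemma edg_flip_node: "edg (flip_node t) = edg t"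
  by (cases t) simp

lemma edg_step:
  assumes "lefts t \<noteq> []"
  shows "map edg (step t) =
    (if lefts (hd (lefts t)) = [] then [edg (snd (leftmost x t)), edg t] else [edg t])"
  using assms
proof (cases t rule: lift.cases)
  case (2 v e s L R)
  then show ?thesis by (cases s rule: lift.cases) (auto simp: step_Cons edg_flip_node)
qed simp

section \<open>Mirror images\<close>

lemma mirror_mirror: "mirror (mirror t) = t"
  by (induction t) (simp add: rev_map[symmetric] map_idI)

lemma mset_vlist_mirror: "mset (vlist (mirror t)) = mset (vlist t)"
proof (induction t)
  case (Node v e L R)
  have "mset (concat (map (vlist \<circ> mirror) ts)) = mset (concat (map vlist ts))"
    if "set ts \<subseteq> set (L @ R)" for ts
    by (rule mset_concat_map_cong) (use that Node in auto)
  from this[of L] this[of R] show ?case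
    by (simp add: rev_map[symmetric] rev_concat mset_concat)
qed

lemma inorder_mirror: "inorder (mirror t) = rev (inorder t)"
proof (induction t)
  case (Node v e L R)
  have "map (inorder \<circ> mirror) ts = map (rev \<circ> inorder) ts"
    if "set ts \<subseteq> set (L @ R)" for ts
    using that Node by auto
  from this[of L] this[of R] show ?case
    by (simp add: rev_map[symmetric] rev_concat del: map_eq_conv)
qed

lemma weight_mirror: "weight n (mirror t) = weight n t"
proof (induction t arbitrary: n)
  case (Node v e L R)
  have "map (weight (Suc n) \<circ> mirror) ts = map (weight (Suc n)) ts"
    if "set ts \<subseteq> set (L @ R)" for ts
    using that Node by auto
  from this[of L] this[of R] show ?case
    by (simp add: rev_map[symmetric] sum_list_rev del: map_eq_conv)
qed

lemma edg_mirror [simp]: "edg (mirror t) = edg t"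
  by (cases t) simp

lemma vtx_mirror [simp]: "vtx (mirror t) = vtx t"
  by (cases t) simp

text \<open>A cyclic list read backwards has the opposite direction; the entering edge
  \<open>a\<close> keeps its place in front, as \<open>drawn\<close> requires.\<close>

lemma cyc_rev_Cons: "cyc (\<not> d) f (a # rev es) \<longleftrightarrow> cyc d f (a # es)"
proof -
  have "map f (rev es @ [a]) = rev (map f (a # es))" "a # rev es = rev (es @ [a])"
    "map f (a # rev es) = rev (map f (es @ [a]))" "rev es @ [a] = rev (a # es)"
    by (simp_all add: rev_map)
  then have *: "map f (a # es) = es @ [a] \<longleftrightarrow> map f (rev es @ [a]) = a # rev es"
    and **: "map f (a # rev es) = rev es @ [a] \<longleftrightarrow> map f (es @ [a]) = a # es"
    by (metis rev_is_rev_conv)+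
  show ?thesis unfolding cyc_def using * ** by (cases d) auto
qed

lemma cyc_rev: "cyc (\<not> d) f (rev es) \<longleftrightarrow> cyc d f es"
proof (cases es)
  case (Cons a as)
  have "cyc (\<not> d) f (rev es) \<longleftrightarrow> cyc (\<not> d) f (a # rev as)"
    using cyc_rotate[of "\<not> d" f "rev as" "[a]"] Cons by simp
  with Cons cyc_rev_Cons show ?thesis by metis
qed (simp add: cyc_def)

lemma orient_swap: "orient (\<not> d) (a, b) = orient d (b, a)"
  by (simp add: orient_def)

text \<open>Neither \<open>G\<close> nor the pointing is reflected: the mirrored tree is a second
  description of the same drawing, read in the other direction. Results proved for every
  \<open>d\<close> thus apply to \<open>mu_plus\<close> by taking \<open>d = False\<close>.\<close>

lemma drawn_mirror: "drawn (\<not> d) G p x (mirror t) \<longleftrightarrow> drawn d G p x t"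
proof (induction t arbitrary: x)
  case (Node v e L R)
  have "map (edg \<circ> mirror) ts = map edg ts" for ts :: "('a, 'b) ptree list" by simp
  then have m: "map edg (rev (map mirror R) @ rev (map mirror L)) = rev (map edg (L @ R))"
    by (simp add: rev_map[symmetric] del: map_eq_conv)
  have "last (e # map edg (rev (map mirror R))) = hd (map edg R @ [e])"
    by (cases R) (auto simp: rev_map)
  moreover have "hd (map edg (rev (map mirror L)) @ [e]) = last (e # map edg L)"
    by (cases L rule: rev_cases) (auto simp: rev_map)
  moreover have "(\<forall>s\<in>set (rev (map mirror R) @ rev (map mirror L)). drawn (\<not> d) G p v s) \<longleftrightarrow>
      (\<forall>s\<in>set (L @ R). drawn d G p v s)"
    using Node.IH by (auto simp: ball_Un)
  ultimately show ?case using cyc_rev_Cons[of d "nxt G v" e "map edg (L @ R)"]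
    by (simp only: mirror.simps drawn.simps m orient_swap)
qed

lemma realized_mirror: "realized d G p ts \<Longrightarrow> realized (\<not> d) G p (rev (map mirror ts))"
proof -
  assume "realized d G p ts"
  then interpret realized d G p ts .
  have mv: "mset (concat (map vlist (rev (map mirror ts)))) = mset (concat (map vlist ts))"
  proof -
    have "mset (concat (map (vlist \<circ> mirror) ts)) = mset (concat (map vlist ts))"
      by (rule mset_concat_map_cong) (simp add: mset_vlist_mirror)
    then show ?thesis by (simp add: rev_map[symmetric] mset_concat)
  qed
  have me: "concat (map inorder (rev (map mirror ts))) = rev (concat (map inorder ts))"
    by (simp add: rev_map rev_concat inorder_mirror comp_def)
  have edg: "map edg (rev (map mirror ts)) = rev (map edg ts)"
    by (simp add: rev_map[symmetric] comp_def)
  show ?thesis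
  proof
    show "verts G = insert (exc G) (set (concat (map vlist (rev (map mirror ts)))))"
      unfolding mset_eq_setD[OF mv] by (rule verts_eq)
    show "edges G = set (concat (map inorder (rev (map mirror ts))))"
      unfolding me by (simp add: edges_eq)
    show "distinct (exc G # concat (map vlist (rev (map mirror ts))))"
      using distinct_verts unfolding distinct.simps mset_eq_setD[OF mv] mset_eq_imp_distinct_iff[OF mv] .
    show "distinct (concat (map inorder (rev (map mirror ts))))"
      unfolding me using distinct_edges by simp
    show "\<forall>t\<in>set (rev (map mirror ts)). drawn (\<not> d) G p (exc G) t"
      using drawn by (simp add: drawn_mirror)
    show "cyc (\<not> d) (nxt G (exc G)) (map edg (rev (map mirror ts)))"
      unfolding edg cyc_rev by (rule cyc_exc)
  qed
qed

section \<open>The walk that finds the centre\<close>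

definition centre :: "bool \<Rightarrow> ('v, 'e) brauer_tree \<Rightarrow> ('v, 'e) pointing \<Rightarrow> 'e \<Rightarrow> 'e" where
  "centre d = (if d then minus_centre else plus_centre)"

definition pointed_at :: "bool \<Rightarrow> ('v, 'e) brauer_tree \<Rightarrow> ('v, 'e) pointing \<Rightarrow> 'v \<Rightarrow> bool" where
  "pointed_at d G p u \<longleftrightarrow>
     p u = orient d (entering G u, turn d G u (entering G u)) \<or> inc G u = {entering G u}"

lemma centre_first_from:
  "centre d G p r = entering G (first_from (pointed_at d G p)
     (\<lambda>u. other G (turn d G u (entering G u)) u) (far_end G r))"
  by (cases d) (auto simp: centre_def minus_centre_def plus_centre_def primary_def coprimary_def
      pointed_at_def[abs_def] turn_def orient_def)

context realized
begin

lemma turn_entering: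
  assumes "(x, Node v e L R) \<in> occ"
  shows "turn d G v (entering G v) = hd (map edg (L @ R) @ [e])"
  using cyc_turn(1)[OF cyc_vtx inc_vtx] assms entering_vtx by fastforce

lemma point_eq:
  assumes "(x, Node v e L R) \<in> occ"
  shows "p v = orient d (e, turn d G v (entering G v)) \<longleftrightarrow> L = []"
proof (cases L rule: rev_cases)
  case Nil
  then show ?thesis using turn_entering[OF assms] point_vtx[OF assms] by simp
next
  case (snoc L' s)
  then have "edg s \<noteq> e" using cyc_vtx[OF assms] by (auto simp: cyc_def)
  then show ?thesis using turn_entering[OF assms] point_vtx[OF assms] snoc
    by (simp add: orient_eq)
qed

text \<open>At the end of a leaf both lists of children are empty, so the two stopping conditions of
  the walk merge into one.\<close>

lemma pointed_at_iff:
  assumes "(x, Node v e L R) \<in> occ"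
  shows "pointed_at d G p v \<longleftrightarrow> L = []"
proof -
  have "inc G v = {e} \<longleftrightarrow> L @ R = []"
    using inc_vtx[OF assms] cyc_vtx[OF assms] by (cases "L @ R") (auto simp: cyc_def)
  then show ?thesis
    unfolding pointed_at_def using point_eq[OF assms] entering_vtx[OF assms] by auto
qed

text \<open>That the walk stops is proved in the same induction, because each unfolding by
  \<open>first_from_go\<close> needs it.\<close>

lemma first_from_leftmost:
  assumes "(x, t) \<in> occ"
  defines "f \<equiv> \<lambda>u. other G (turn d G u (entering G u)) u"
  shows "first_from (pointed_at d G p) f (vtx t) = vtx (snd (leftmost x t)) \<and>
    (\<exists>n. pointed_at d G p ((f ^^ n) (vtx t)))"
  using assms(1)
proof (induction x t rule: leftmost.induct)
  case (1 x v e R)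
  then have "pointed_at d G p v" using pointed_at_iff by blast
  then show ?case using first_from_stop[of "pointed_at d G p" v] by (auto intro: exI[of _ 0])
next
  case (2 x v e t L R)
  have t: "(v, t) \<in> occ" by (rule occ_child[OF 2(2)]) simp
  have "turn d G v (entering G v) = edg t" using turn_entering[OF 2(2)] by simp
  then have fv: "f v = vtx t" unfolding f_def using other_eq[OF t] by simp
  have "\<not> pointed_at d G p v" using pointed_at_iff[OF 2(2)] by simp
  moreover from 2(1)[OF t] obtain n where n: "pointed_at d G p ((f ^^ n) (f v))" unfolding fv by blast
  ultimately have "first_from (pointed_at d G p) f v = first_from (pointed_at d G p) f (f v)"
    by (rule first_from_go)
  moreover from n have "pointed_at d G p ((f ^^ Suc n) v)" by (simp add: funpow_swap1)
  then have "\<exists>n. pointed_at d G p ((f ^^ n) v)" by blast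
  ultimately show ?case using 2(1)[OF t] unfolding fv by simp
qed

lemma centre_leftmost:
  assumes "t \<in> set ts"
  shows "centre d G p (edg t) = edg (snd (leftmost (exc G) t))"
proof -
  note t = occ_root[OF assms]
  have "(fst (leftmost (exc G) t), snd (leftmost (exc G) t)) \<in> occ"
    using leftmost_nlist assms by (force simp: forest_nodes_def)
  from entering_vtx[OF this] first_from_leftmost[OF t] show ?thesis
    unfolding centre_first_from far_end_edg[OF t] by simp
qed

text \<open>If the first left child has left children itself, the walk goes on below it, and the
  near end of the centre is farther from \<open>exc G\<close> than \<open>vtx t\<close>.\<close>

lemma near_end_centre:
  assumes "t \<in> set ts" "lefts t \<noteq> []"
  shows "near_end G (edg (snd (leftmost (exc G) t))) = vtx t \<longleftrightarrow> lefts (hd (lefts t)) = []"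
proof -
  have "(fst (leftmost (exc G) t), snd (leftmost (exc G) t)) \<in> occ"
    using leftmost_nlist assms by (force simp: forest_nodes_def)
  then have ne: "near_end G (edg (snd (leftmost (exc G) t))) = fst (leftmost (exc G) t)"
    by (rule near_end_edg)
  obtain v e s L R where t: "t = Node v e (s # L) R" using assms(2) by (cases t rule: lift.cases) auto
  have "fst (leftmost v s) \<noteq> v" if nonempty: "lefts s \<noteq> []"
  proof -
    obtain w i s' L' R' where s: "s = Node w i (s' # L') R'" using nonempty by (cases s rule: lift.cases) auto
    have "(exc G, t) \<in> occ" using occ_root[OF assms(1)] .
    then have sv: "(v, s) \<in> occ" unfolding t by (rule occ_child) simp
    then have sw: "(w, s') \<in> occ" unfolding s by (rule occ_child) simp
    have *: "distance G w' \<le> distance G (fst (leftmost w' s'))" if "(w', s') \<in> occ" for w' s'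
      using that
    proof (induction w' s' rule: leftmost.induct)
      case (2 x v e t L R)
      have "(v, t) \<in> occ" by (rule occ_child[OF 2(2)]) simp
      with 2 distance_vtx[OF 2(2)] show ?case by fastforce
    qed simp
    from *[OF sw] distance_vtx[OF sv] s show ?thesis by auto
  qed
  moreover have "fst (leftmost v s) = v" if "lefts s = []"
    using that by (cases s) auto
  ultimately show ?thesis using ne t by auto
qed

end

section \<open>Runs of the algorithm\<close>

text \<open>Taking \<open>takeWhile\<close> from either end makes reversal of the word a mere swap
  of the two sets, which suits mirror images.\<close>

definition sides :: "'e \<Rightarrow> 'e list \<Rightarrow> 'e set \<times> 'e set" where
  "sides r es = (set (takeWhile ((\<noteq>) r) es), set (takeWhile ((\<noteq>) r) (rev es)))"

lemma sides_rev: "sides r (rev es) = prod.swap (sides r es)"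
  by (simp add: sides_def)

lemma sides_replace:
  assumes "r \<notin> set P" "set P' = set P"
  shows "sides r (X @ P' @ Y) = sides r (X @ P @ Y)"
  using assms by (auto simp: sides_def takeWhile_append)

lemma sides_split:
  assumes "r \<notin> set X" "r \<notin> set Y"
  shows "sides r (X @ r # Y) = (set X, set Y)"
  using assms by (auto simp: sides_def takeWhile_append takeWhile_eq_all_conv)

abbreviation forest_inorder :: "('v, 'e) ptree list \<Rightarrow> 'e list" where
  "forest_inorder ts \<equiv> concat (map inorder ts)"

abbreviation forest_weight :: "('v, 'e) ptree list \<Rightarrow> nat" where
  "forest_weight ts \<equiv> sum_list (map (weight 1) ts)"

abbreviation mirror_forest :: "('v, 'e) ptree list \<Rightarrow> ('v, 'e) ptree list" where
  "mirror_forest ts \<equiv> rev (map mirror ts)"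

lemma mirror_forest_mirror: "mirror_forest (mirror_forest ts) = ts"
  by (simp add: rev_map[symmetric] comp_def mirror_mirror)

lemma forest_inorder_mirror: "forest_inorder (mirror_forest ts) = rev (forest_inorder ts)"
  by (simp add: rev_map rev_concat inorder_mirror comp_def)

lemma forest_weight_mirror: "forest_weight (mirror_forest ts) = forest_weight ts"
  by (simp add: rev_map[symmetric] comp_def weight_mirror sum_list_rev)

lemma edg_inorder: "edg t \<in> set (inorder t)"
  by (cases t) simp

text \<open>Edges at \<open>exc G\<close> may be added but are not lost, so the fixed root
  \<open>r0\<close> remains a root and can serve for the next mutation too.\<close>

definition advances :: "bool \<Rightarrow> ('v, 'e) brauer_tree \<Rightarrow> ('v, 'e) pointing \<Rightarrow> 'e \<Rightarrow>
    ('v, 'e) ptree list \<Rightarrow> ('v, 'e) brauer_tree \<Rightarrow> ('v, 'e) pointing \<Rightarrow> ('v, 'e) ptree list \<Rightarrow> bool" where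
  "advances d G p r0 ts G' p' ts' \<longleftrightarrow>
     realized d G' p' ts' \<and> exc G' = exc G \<and> edges G' = edges G \<and>
     forest_weight ts' < forest_weight ts \<and>
     edg ` set ts \<subseteq> edg ` set ts' \<and>
     sides r0 (forest_inorder ts') = sides r0 (forest_inorder ts)"

lemma advances_step:
  assumes "realized d G p (A @ t # B)" and "lefts t \<noteq> []" and r0: "r0 \<in> edg ` set (A @ t # B)"
  defines "i \<equiv> centre d G p (edg t)"
  shows "\<exists>G' p'. mutation d i (G, p) = (G', p') \<and>
    advances d G p r0 (A @ t # B) G' p' (A @ step t @ B) \<and>
    map edg (step t) = (if near_end G i = vtx t then [i, edg t] else [edg t])"
proof -
  interpret realized d G p "A @ t # B" by fact
  have i: "i = edg (snd (leftmost (exc G) t))" unfolding i_def by (rule centre_leftmost) simp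
  from realized_step[OF assms(1,2)] obtain G' p' where *: "mutation d i (G, p) = (G', p')"
    "exc G' = exc G" "realized d G' p' (A @ step t @ B)" unfolding i by blast
  have es: "map edg (step t) = (if near_end G i = vtx t then [i, edg t] else [edg t])"
    using edg_step[OF assms(2), of "exc G"] near_end_centre[of t] assms(2) unfolding i by simp
  from inorder_step[OF assms(2)] obtain P P' Q where PQ: "inorder t = P @ Q"
    "forest_inorder (step t) = P' @ Q" "set P' = set P" "edg t \<in> set Q" by blast
  \<comment> \<open>If \<open>r0\<close> is not the edge of \<open>t\<close>, it is the root of a
    tree in \<open>A\<close> or \<open>B\<close>; in each case it lies outside the permuted prefix
    \<open>P\<close>.\<close>
  have "r0 \<in> set (forest_inorder A) \<union> set Q \<union> set (forest_inorder B)"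
    using r0 PQ(4) edg_inorder by fastforce
  then have "r0 \<notin> set P" using distinct_edges PQ(1) by auto
  from sides_replace[OF this PQ(3), of "forest_inorder A" "Q @ forest_inorder B"]
  have "sides r0 (forest_inorder (A @ step t @ B)) = sides r0 (forest_inorder (A @ t # B))"
    using PQ by simp
  moreover have "edges G' = edges G"
    unfolding realized.edges_eq[OF *(3)] edges_eq using PQ by auto
  moreover have "edg t \<in> edg ` set (step t)"
    using arg_cong[OF es, of set] by (auto split: if_splits)
  ultimately show ?thesis using * es weight_step[OF assms(2), of 1] by (auto simp: advances_def)
qed

lemma advances_mirror:
  assumes "advances d G p r0 (mirror_forest ts) G' p' ts'"
  shows "advances (\<not> d) G p r0 ts G' p' (mirror_forest ts')"
proof -
  have "edg ` set (mirror_forest us) = edg ` set us" for us :: "('a, 'b) ptree list"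
    by (auto simp: image_image)
  then show ?thesis
    using assms realized_mirror[of d G' p' ts']
    unfolding advances_def forest_weight_mirror forest_inorder_mirror sides_rev
    by (metis (no_types, lifting) prod.swap_def swap_swap forest_inorder_mirror sides_rev)
qed

text \<open>As the tree is a single branch, the initial branch comprises all edges \<open>E\<close>, so a new initial
  branch is never chosen.\<close>

definition run_state :: "'e \<Rightarrow> 'e set \<times> 'e set \<Rightarrow> 'e set \<Rightarrow> ('v, 'e) kstate \<Rightarrow> ('v, 'e) ptree list \<Rightarrow> bool" where
  "run_state r0 S E s ts \<longleftrightarrow>
     realized True (tree s) (point s) ts \<and> ts \<noteq> [] \<and> start s = edg (hd ts) \<and>
     current s \<in> edg ` set ts \<and> initial s = E \<and> edges (tree s) = E \<and>
     r0 \<in> edg ` set ts \<and> sides r0 (forest_inorder ts) = S"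

lemma run_state_advances:
  assumes "run_state r0 S E s ts" "advances True (tree s) (point s) r0 ts (tree s') (point s') ts'"
    and "initial s' = initial s" "start s' = edg (hd ts')" "current s' \<in> edg ` set ts'"
  shows "run_state r0 S E s' ts'"
proof -
  have "ts' \<noteq> []" using assms(1,2) by (auto simp: run_state_def advances_def)
  with assms show ?thesis by (auto simp: run_state_def advances_def)
qed

lemma run_state_mutate:
  assumes "run_state r0 S E s ts" and "\<not> leaf_branch (tree s) (current s)"
  shows "\<exists>ts'. run_state r0 S E (mutate s) ts' \<and> forest_weight ts' < forest_weight ts"
proof -
  let ?G = "tree s" and ?p = "point s"
  interpret realized True ?G ?p ts using assms(1) by (simp add: run_state_def)
  from assms(1) obtain t where t: "t \<in> set ts" "edg t = current s" by (auto simp: run_state_def)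
  then obtain A B where ts: "ts = A @ t # B" by (meson split_list)
  obtain v L R where teq: "t = Node v (current s) L R" using t(2) by (cases t) auto
  have tocc: "(exc ?G, Node v (current s) L R) \<in> occ" using occ_root[OF t(1)] teq by simp
  have u: "far_end ?G (current s) = v" using far_end_edg[OF tocc] by simp
  have pt: "?p v = (current s, primary ?G v) \<longleftrightarrow> L = []"
    using point_eq[OF tocc] by (simp add: orient_def turn_def primary_def)
  have LR: "L \<noteq> [] \<or> R \<noteq> []" using assms(2) leaf_branch_root t(1) teq by metis
  have r0: "r0 \<in> edg ` set (A @ t # B)" using assms(1) ts by (simp add: run_state_def)
  have dr: "distinct (map edg ts)" using cyc_exc by (simp add: cyc_def)
  have start: "start s = edg (hd ts)" "ts \<noteq> []" using assms(1) by (simp_all add: run_state_def)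
  \<comment> \<open>The roots are distinct, so the first edge is the current root exactly when
    \<open>A\<close> is empty. This is the test by which \<open>mutate\<close> decides whether a new
    root becomes the first edge.\<close>
  have start_A: "start s = (if A = [] then current s else edg (hd A))"
      "A \<noteq> [] \<Longrightarrow> start s \<noteq> current s"
    using start dr t(2) unfolding ts by (cases A; auto)+
  show ?thesis
  proof (cases "L = []")
    case False
    let ?i = "centre True ?G ?p (current s)"
    from False have "lefts t \<noteq> []" using teq by simp
    from advances_step[OF realized_axioms[unfolded ts] this r0] obtain G' p'
      where *: "mu_minus ?i (?G, ?p) = (G', p')"
        "advances True ?G ?p r0 ts G' p' (A @ step t @ B)"
        "map edg (step t) = (if near_end ?G ?i = v then [?i, current s] else [current s])"
      unfolding t(2) ts[symmetric] by (auto simp: mutation_def teq)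
    have m: "mutate s = s\<lparr>tree := G', point := p',
        current := (if near_end ?G ?i = v then ?i else current s),
        start := (if near_end ?G ?i = v \<and> start s = current s then ?i else start s)\<rparr>"
      unfolding mutate_def using pt False *(1) by (simp add: Let_def u centre_def)
    have ne: "step t \<noteq> []" using *(3) by (auto split: if_splits)
    have "edg (hd (step t)) = (if near_end ?G ?i = v then ?i else current s)"
      using *(3) ne by (metis hd_map list.sel(1))
    moreover have "edg (hd (step t)) \<in> edg ` set (A @ step t @ B)" using ne by simp
    moreover have "hd (A @ step t @ B) = (if A = [] then hd (step t) else hd A)"
      using ne by (simp add: hd_append)
    ultimately have "run_state r0 S E (mutate s) (A @ step t @ B)"
      using *(2) start_A by (intro run_state_advances[OF assms(1)]) (simp_all add: m split: if_splits)
    with *(2) show ?thesis unfolding advances_def by blast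
  next
    case True
    \<comment> \<open>Here \<open>mu_plus\<close> applies. It is treated as the mutation with
      \<open>d = False\<close> of the mirrored forest, where \<open>B\<close> comes before
      \<open>A\<close> and, as \<open>R\<close> is not empty, the current branch has left
      children.\<close>
    let ?i = "centre False ?G ?p (current s)" and ?t = "mirror t"
    have "lefts ?t \<noteq> []" using True LR teq by simp
    moreover have mf: "mirror_forest ts = mirror_forest B @ ?t # mirror_forest A" by (simp add: ts)
    moreover have "realized False ?G ?p (mirror_forest B @ ?t # mirror_forest A)"
      using realized_mirror[OF realized_axioms] unfolding mf by simp
    moreover have "r0 \<in> edg ` set (mirror_forest B @ ?t # mirror_forest A)"
      using r0 by (simp add: image_Un image_image) blast
    ultimately obtain G' p'
      where *: "mu_plus ?i (?G, ?p) = (G', p')"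
        "advances False ?G ?p r0 (mirror_forest ts) G' p'
           (mirror_forest B @ step ?t @ mirror_forest A)"
        "map edg (step ?t) = (if near_end ?G ?i = v then [?i, current s] else [current s])"
      using advances_step[of False ?G ?p "mirror_forest B" ?t "mirror_forest A" r0]
      by (auto simp: mutation_def teq)
    let ?ts = "A @ mirror_forest (step ?t) @ B"
    have eq: "mirror_forest (mirror_forest B @ step ?t @ mirror_forest A) = ?ts"
      using mirror_forest_mirror[of A] mirror_forest_mirror[of B] by simp
    from advances_mirror[OF *(2)] have adv: "advances True ?G ?p r0 ts G' p' ?ts"
      unfolding eq by simp
    have m: "mutate s = s\<lparr>tree := G', point := p',
        current := (if near_end ?G ?i = v then ?i else current s)\<rparr>"
      unfolding mutate_def using pt True *(1) by (simp add: Let_def u centre_def)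
    \<comment> \<open>Mirrored back, a new root stands after the current one, so the first edge does
      not change.\<close>
    have es: "map edg (mirror_forest (step ?t)) =
        (if near_end ?G ?i = v then [current s, ?i] else [current s])"
      using arg_cong[OF *(3), of rev] by (simp add: rev_map comp_def)
    then have ne: "mirror_forest (step ?t) \<noteq> []" by (auto split: if_splits)
    have "edg (hd (mirror_forest (step ?t))) = current s"
      using es ne by (metis hd_map list.sel(1))
    moreover have "(if near_end ?G ?i = v then ?i else current s) \<in> edg ` set ?ts"
    proof -
      have "(if near_end ?G ?i = v then ?i else current s) \<in> set (map edg (mirror_forest (step ?t)))"
        unfolding es by simp
      then show ?thesis by (simp only: set_map set_append image_Un Un_iff simp_thms)
    qed
    moreover have "hd ?ts = (if A = [] then hd (mirror_forest (step ?t)) else hd A)"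
      using ne by (simp only: hd_append2 hd_append append_is_Nil_conv if_False)
    moreover have "tree (mutate s) = G'" "point (mutate s) = p'" "initial (mutate s) = initial s"
      "start (mutate s) = start s"
      "current (mutate s) = (if near_end ?G ?i = v then ?i else current s)"
      by (simp_all add: m)
    ultimately have "run_state r0 S E (mutate s) ?ts"
      using adv start_A(1) by (intro run_state_advances[OF assms(1)]) metis+
    with adv show ?thesis unfolding advances_def by blast
  qed
qed

lemma run_state_step:
  assumes "kozakai_step s s'" and "run_state r0 S E s ts"
  shows "\<exists>ts'. run_state r0 S E s' ts'"
  using assms(1)
proof cases
  case mutate
  then show ?thesis using run_state_mutate[OF assms(2)] by blast
next
  case (choose_current r)
  interpret realized True "tree s" "point s" ts using assms(2) by (simp add: run_state_def)
  from choose_current assms(2) show ?thesis by (auto simp: run_state_def inc_exc)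
next
  case (choose_initial r)
  then have "r \<in> edges (tree s)" by (simp add: inc_def)
  with choose_initial assms(2) show ?thesis by (auto simp: run_state_def)
qed

lemma run_state_steps:
  assumes "kozakai_step\<^sup>*\<^sup>* s s'" and "run_state r0 S E s ts"
  shows "\<exists>ts'. run_state r0 S E s' ts'"
  using assms
proof (induction rule: rtranclp_induct)
  case (step s' s'')
  then obtain us where "run_state r0 S E s' us" by auto
  with step(2) show ?case using run_state_step by fast
qed auto

text \<open>A change of the current branch does not lower the weight, so the induction joins it to
  the mutation that follows. The change is permitted because the initial branch contains all
  edges.\<close>

lemma run_state_terminates:
  assumes "run_state r0 S E s ts"
  shows "\<exists>t. kozakai_step\<^sup>*\<^sup>* s t \<and> is_star (tree t)"
  using assms
proof (induction "forest_weight ts" arbitrary: s ts rule: less_induct)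
  case less
  interpret realized True "tree s" "point s" ts using less.prems by (simp add: run_state_def)
  show ?case
  proof (cases "is_star (tree s)")
    case False
    then obtain t where t: "t \<in> set ts" "\<not> (lefts t = [] \<and> rights t = [])"
      using is_star_leaves by blast
    then have nl: "\<not> leaf_branch (tree s) (edg t)" using leaf_branch_root[of "vtx t" "edg t" "lefts t" "rights t"] by simp
    have "\<exists>s'. kozakai_step\<^sup>*\<^sup>* s s' \<and> run_state r0 S E s' ts \<and> \<not> leaf_branch (tree s') (current s')"
    proof (cases "leaf_branch (tree s) (current s)")
      case True
      let ?s = "s\<lparr>current := edg t\<rparr>"
      have "edg t \<in> inc (tree s) (exc (tree s))" using t(1) inc_exc by simp
      moreover have "branch (tree s) (edg t) \<subseteq> initial s"
        using less.prems by (auto simp: branch_def run_state_def)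
      ultimately have "kozakai_step s ?s" using True nl by (intro kozakai_step.choose_current)
      moreover have "run_state r0 S E ?s ts" using less.prems t(1) by (simp add: run_state_def)
      ultimately show ?thesis using nl by (intro exI[of _ ?s]) simp
    qed (use less.prems in blast)
    then obtain s' where s': "kozakai_step\<^sup>*\<^sup>* s s'" "run_state r0 S E s' ts"
      "\<not> leaf_branch (tree s') (current s')" by blast
    from run_state_mutate[OF s'(2,3)] obtain ts'
      where "run_state r0 S E (mutate s') ts'" "forest_weight ts' < forest_weight ts" by blast
    from less.hyps[OF this(2,1)] obtain t where "kozakai_step\<^sup>*\<^sup>* (mutate s') t" "is_star (tree t)"
      by blast
    moreover have "kozakai_step s' (mutate s')" by (rule kozakai_step.mutate[OF s'(3)])
    ultimately show ?thesis using s'(1) by (meson converse_rtranclp_into_rtranclp rtranclp_trans)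
  qed blast
qed

section \<open>The final reading as a permutation\<close>

lemma cyc_True_iterate:
  assumes "cyc True f es" "n < length es"
  shows "(f ^^ n) (hd es) = es ! n"
  using assms(2)
proof (induction n)
  case 0
  then show ?case by (simp add: hd_conv_nth)
next
  case (Suc n)
  have "f (es ! n) = rotate1 es ! n"
    using assms(1) Suc.prems by (metis Suc_lessD cyc_def nth_map)
  also have "\<dots> = es ! Suc n"
    using Suc.prems by (cases es) (auto simp: nth_append)
  finally show ?case using Suc by simp
qed

lemma run_state_reading:
  assumes "run_state r0 S E s ts" "is_star (tree s)"
  shows "reading s = forest_inorder ts"
proof -
  interpret realized True "tree s" "point s" ts using assms(1) by (simp add: run_state_def)
  from assms(2) have leaves: "\<forall>t\<in>set ts. lefts t = [] \<and> rights t = []"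
    using is_star_leaves by blast
  have "inorder t = [edg t]" if "t \<in> set ts" for t
    using leaves that by (cases t) auto
  then have eq: "forest_inorder ts = map edg ts" by (induction ts) auto
  have "card (edges (tree s)) = length (map edg ts)"
    unfolding edges_eq eq using distinct_edges eq by (metis distinct_card)
  then show ?thesis unfolding eq reading_def
    using cyc_True_iterate[OF cyc_exc] assms(1)
    by (intro nth_equalityI) (auto simp: run_state_def hd_map)
qed

text \<open>The bound \<open>hi \<ge> lo - 1\<close> admits the empty interval, which occurs when
  the root has the least or the greatest number, and keeps \<open>hi - lo + 1\<close> equal to the
  length of the list.\<close>

lemma permutes_reading:
  fixes num :: "'e \<Rightarrow> int"
  assumes "distinct es" "inj_on num (set es)" "num ` set es = {lo..hi}" "hi \<ge> lo - 1"
  shows "(\<lambda>i. if i \<in> {lo..hi} then num (es ! nat (i - lo)) else i) permutes {lo..hi}"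
proof (rule bij_imp_permutes)
  have len: "int (length es) = hi - lo + 1"
    using card_image[OF assms(2)] assms(1,3,4) by (simp add: distinct_card)
  have "bij_betw (\<lambda>i. nat (i - lo)) {lo..hi} {..<length es}"
    by (rule bij_betwI[where g = "\<lambda>n. lo + int n"]) (use len in auto)
  moreover have "bij_betw ((!) es) {..<length es} (set es)"
    using assms(1) by (simp add: bij_betw_nth)
  moreover have "bij_betw num (set es) {lo..hi}" using assms(2,3) by (simp add: bij_betw_def)
  ultimately have "bij_betw (num \<circ> ((!) es \<circ> (\<lambda>i. nat (i - lo)))) {lo..hi} {lo..hi}"
    by (blast intro: bij_betw_trans)
  then show "bij_betw (\<lambda>i. if i \<in> {lo..hi} then num (es ! nat (i - lo)) else i) {lo..hi} {lo..hi}"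
    by (rule iffD1[OF bij_betw_cong, rotated]) simp
qed auto

text \<open>The left sides of both words have the same elements without repetition, hence the same
  length, so \<open>r\<close> keeps its position \<open>c - a\<close>. Each part of the reading then
  permutes the numbers of its own side.\<close>

lemma permutation_splits:
  fixes num :: "'e \<Rightarrow> int"
  assumes num: "map num es0 = [a..b]" and es: "distinct es" "set es = set es0"
    and r: "r \<in> set es0" "num r = c" and sides: "sides r es = sides r es0"
  defines "\<sigma> \<equiv> \<lambda>i. if i \<in> {a..b} then num (es ! nat (i - a)) else i"
  shows "\<exists>\<pi>\<^sub>L \<pi>\<^sub>R. \<pi>\<^sub>L permutes {a..c - 1} \<and> \<pi>\<^sub>R permutes {c + 1..b} \<and> \<sigma> = \<pi>\<^sub>L \<circ> \<pi>\<^sub>R"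
proof -
  have "distinct (map num es0)" unfolding num by simp
  then have dist0: "distinct es0" and inj: "inj_on num (set es0)" by (simp_all add: distinct_map)
  have "num ` set es0 = {a..b}" using num by (metis list.set_map set_upto)
  with r have c: "a \<le> c" "c \<le> b" by auto
  obtain X Y where XY: "es0 = X @ r # Y" using r(1) by (meson split_list)
  obtain X' Y' where XY': "es = X' @ r # Y'" using r(1) es(2) by (metis split_list)
  have S: "set X' = set X" "set Y' = set Y"
    using sides dist0 es(1) unfolding XY XY' by (simp_all add: sides_split)
  have "map num X @ c # map num Y = [a..c - 1] @ c # [c + 1..b]"
    using num r(2) c upto_split3[of a c b] unfolding XY by simp
  moreover have "c \<notin> set (map num X)" "c \<notin> set (map num Y)"
    using inj dist0 r(2) unfolding XY by (auto simp: inj_on_def)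
  ultimately have m: "map num X = [a..c - 1]" "map num Y = [c + 1..b]"
    by (simp_all add: append_Cons_eq_iff)
  have imX: "num ` set X' = {a..c - 1}" and imY: "num ` set Y' = {c + 1..b}"
    using m unfolding S by (metis list.set_map set_upto)+
  have injX: "inj_on num (set X')" and injY: "inj_on num (set Y')"
    using inj unfolding S XY by (auto intro: inj_on_subset)
  have dX: "distinct X'" "distinct Y'" using es(1) XY' by auto
  have "length X' = length X" using S(1) dist0 dX(1) unfolding XY by (metis distinct_append distinct_card)
  moreover have "length X = nat (c - a)" using arg_cong[OF m(1), of length] by simp
  ultimately have lX: "int (length X') = c - a" using c by simp
  let ?L = "\<lambda>i. if i \<in> {a..c - 1} then num (X' ! nat (i - a)) else i"
  let ?R = "\<lambda>i. if i \<in> {c + 1..b} then num (Y' ! nat (i - (c + 1))) else i"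
  have L: "?L permutes {a..c - 1}"
    by (rule permutes_reading) (use dX injX imX c in auto)
  have R: "?R permutes {c + 1..b}"
    by (rule permutes_reading) (use dX injY imY c in auto)
  have "\<sigma> i = (?L \<circ> ?R) i" for i
  proof -
    consider "i \<notin> {a..b}" | "i \<in> {a..c - 1}" | "i = c" | "i \<in> {c + 1..b}" by force
    then show ?thesis
    proof cases
      case 1
      with c show ?thesis by (auto simp: \<sigma>_def)
    next
      case 2
      then have "nat (i - a) < length X'" using lX by auto
      with 2 c show ?thesis unfolding \<sigma>_def XY' by (auto simp: nth_append)
    next
      case 3
      then have "nat (i - a) = length X'" using lX by auto
      with 3 c r(2) show ?thesis unfolding \<sigma>_def XY' by (auto simp: nth_append)
    next
      case 4
      then have n: "nat (i - a) = Suc (length X' + nat (i - (c + 1)))" using lX by auto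
      \<comment> \<open>The right factor acts first and stays in its interval, where the left factor
        is the identity.\<close>
      have "?R i \<in> {c + 1..b}" using permutes_in_image[OF R] 4 by blast
      then have "?L (?R i) = ?R i" by auto
      with 4 c n show ?thesis unfolding \<sigma>_def XY' by (auto simp: nth_append)
    qed
  qed
  with L R show ?thesis by blast
qed

section \<open>Green's walk\<close>

text \<open>A stretch of Green's walk from any state. The circuit in \<open>green_sectors\<close> is
  the case of \<open>2 * card (edges G)\<close> steps; the induction over subtrees needs the shorter
  ones.\<close>

definition trace :: "('v, 'e) brauer_tree \<Rightarrow> nat \<Rightarrow> 'v \<times> 'e \<Rightarrow> ('v \<times> 'e \<times> 'e) list" where
  "trace G n s = map (\<lambda>n. let (u, i) = (green_step G ^^ n) s; w = other G i u in (w, i, nxt G w i)) [0..<n]"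

definition met :: "('v, 'e) brauer_tree \<Rightarrow> ('v, 'e) pointing \<Rightarrow> ('v \<times> 'e \<times> 'e) list \<Rightarrow> 'e list" where
  "met G p ss = map (\<lambda>s. entering G (fst s)) (filter (\<lambda>(w, s). w \<noteq> exc G \<and> s = p w) ss)"

lemma trace_add: "trace G (m + n) s = trace G m s @ trace G n ((green_step G ^^ m) s)"
proof -
  have "[0..<m + n] = [0..<m] @ map (\<lambda>k. k + m) [0..<n]"
    using upt_add_eq_append[of 0 m n] map_add_upt[of m n] by (simp only: add.commute[of m n] le0)
  then show ?thesis
    unfolding trace_def by (simp add: comp_def funpow_add)
qed

lemma trace_Suc0: "trace G (Suc 0) (u, i) = [(other G i u, i, nxt G (other G i u) i)]"
  by (simp add: trace_def Let_def)

lemma met_append: "met G p (ss @ ss') = met G p ss @ met G p ss'"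
  by (simp add: met_def)

lemma cyc_True_last:
  assumes "cyc True f (e # as @ bs)"
  shows "f (last (e # as)) = hd (bs @ [e])"
proof -
  from assms have m: "map f (e # as @ bs) = as @ bs @ [e]" by (simp add: cyc_def)
  have "last (e # as) = (e # as @ bs) ! length as"
    by (cases as rule: rev_cases) (auto simp: nth_append)
  then have "f (last (e # as)) = map f (e # as @ bs) ! length as"
    by (metis nth_map length_Cons length_append le_imp_less_Suc le_add1)
  also have "\<dots> = hd (bs @ [e])" unfolding m by (simp add: nth_append hd_conv_nth)
  finally show ?thesis .
qed

text \<open>The round trip through a subtree uses each of its edges twice. Its last step arrives at
  \<open>x\<close> and passes the sector after \<open>edg t\<close>; if the point of
  \<open>x\<close> lies there, the entering edge of \<open>x\<close> is recorded, which is the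
  optional last entry.\<close>

lemma (in realized) green_subtree:
  assumes "d" and "(x, t) \<in> occ"
  shows "(green_step G ^^ (2 * length (inorder t))) (x, edg t) = (x, nxt G x (edg t)) \<and>
    met G p (trace G (2 * length (inorder t)) (x, edg t)) =
      inorder t @ (if x \<noteq> exc G \<and> p x = (edg t, nxt G x (edg t)) then [entering G x] else [])"
  using assms(2)
proof (induction t arbitrary: x)
  case (Node v e L R)
  note occ = Node.prems
  have vne: "v \<noteq> exc G" using occ_vtx(2)[OF occ] by simp
  have ent: "entering G v = e" using entering_vtx[OF occ] by simp
  have oth: "other G e x = v" "other G e v = x" using other_eq[OF occ] by simp_all
  have cyc: "cyc True (nxt G v) (e # map edg (L @ R))" using cyc_vtx[OF occ] assms(1) by simp
  define q where "q = last (e # map edg L)"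
  have q: "p v = (q, nxt G v q)"
    using point_vtx[OF occ] cyc_True_last[of "nxt G v" e "map edg L" "map edg R"] cyc assms(1)
    by (simp add: q_def orient_def)
  have sector: "p v = (f, nxt G v f) \<longleftrightarrow> f = q" for f using q by auto
  let ?mark = "\<lambda>f. if f = q then [e] else []"
  let ?out = "\<lambda>cs. concat (map (\<lambda>c. inorder c @ ?mark (edg c)) cs)"
  \<comment> \<open>Stated for consecutive children \<open>cs\<close>, with \<open>f\<close> the
    edge before and \<open>g\<close> the edge after them, to permit induction;
    \<open>f = g = e\<close> gives the full turn around \<open>v\<close>.\<close>
  have children: "(green_step G ^^ (2 * length (forest_inorder cs))) (v, nxt G v f) = (v, g) \<and>
      met G p (trace G (2 * length (forest_inorder cs)) (v, nxt G v f)) = ?out cs"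
    if "set cs \<subseteq> set (L @ R)" "map (nxt G v) (f # map edg cs) = map edg cs @ [g]" for cs f g
    using that
  proof (induction cs arbitrary: f)
    case Nil
    then show ?case by (simp add: trace_def met_def)
  next
    case (Cons c cs)
    have c: "(v, c) \<in> occ" by (rule occ_child[OF occ]) (use Cons.prems(1) in simp)
    have f: "nxt G v f = edg c" using Cons.prems(2) by simp
    have "c \<in> set L \<or> c \<in> set R" using Cons.prems(1) by simp
    then have c': "(green_step G ^^ (2 * length (inorder c))) (v, edg c) = (v, nxt G v (edg c))"
        "met G p (trace G (2 * length (inorder c)) (v, edg c)) = inorder c @ ?mark (edg c)"
      using Node.IH c vne sector ent by auto
    have IH: "(green_step G ^^ (2 * length (forest_inorder cs))) (v, nxt G v (edg c)) = (v, g)"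
      "met G p (trace G (2 * length (forest_inorder cs)) (v, nxt G v (edg c))) = ?out cs"
      using Cons.IH[of "edg c"] Cons.prems by auto
    have len: "2 * length (forest_inorder (c # cs)) =
        2 * length (inorder c) + 2 * length (forest_inorder cs)" by simp
    show ?case unfolding len trace_add met_append f c'(1) c'(2) IH(2)
      using IH(1) c'(1) by (simp add: funpow_add add.commute[of "2 * length (inorder c)"])
  qed
  have ch: "(green_step G ^^ (2 * length (forest_inorder (L @ R)))) (v, nxt G v e) = (v, e)"
      "met G p (trace G (2 * length (forest_inorder (L @ R))) (v, nxt G v e)) = ?out (L @ R)"
    using children[of "L @ R" e e] cyc by (simp_all add: cyc_def)
  have len: "2 * length (inorder (Node v e L R)) =
      Suc 0 + (2 * length (forest_inorder (L @ R)) + Suc 0)" by simp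
  have s1: "(green_step G ^^ Suc 0) (x, e) = (v, nxt G v e)"
    and s2: "(green_step G ^^ Suc 0) (v, e) = (x, nxt G x e)"
    using oth by (simp_all add: green_step_def Let_def)
  have walk: "(green_step G ^^ (Suc 0 + (2 * length (forest_inorder (L @ R)) + Suc 0))) (x, e)
      = (x, nxt G x e)"
    by (simp only: funpow_add comp_apply s1 s2 ch(1))
  \<comment> \<open>Exactly one of \<open>e\<close> and the child edges is \<open>q\<close>: the
    last left child, or \<open>e\<close> if there is none. So \<open>e\<close> is recorded between
    the left and the right words.\<close>
  have "?mark e @ ?out (L @ R) = inorder (Node v e L R)"
  proof -
    have dist: "distinct (e # map edg (L @ R))" using cyc by (simp add: cyc_def)
    have none: "?out cs = forest_inorder cs" if "q \<notin> edg ` set cs" for cs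
      using that by (induction cs) auto
    show ?thesis
    proof (cases L rule: rev_cases)
      case Nil
      then have "q = e" by (simp add: q_def)
      with none[of R] dist Nil show ?thesis by auto
    next
      case (snoc L' c)
      then have "q = edg c" by (simp add: q_def)
      with none[of R] none[of L'] dist snoc show ?thesis by auto
    qed
  qed
  moreover have "met G p (trace G (Suc 0) (x, e)) = ?mark e"
    unfolding trace_Suc0 oth met_def using vne ent sector[of e] by auto
  ultimately have "met G p (trace G (Suc 0) (x, e)) @ ?out (L @ R) = inorder (Node v e L R)"
    by simp
  note first = this
  have last: "met G p (trace G (Suc 0) (v, e)) =
      (if x \<noteq> exc G \<and> p x = (e, nxt G x e) then [entering G x] else [])"
    unfolding trace_Suc0 oth met_def by auto
  have "met G p (trace G (Suc 0 + (2 * length (forest_inorder (L @ R)) + Suc 0)) (x, e)) =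
      inorder (Node v e L R) @ (if x \<noteq> exc G \<and> p x = (e, nxt G x e) then [entering G x] else [])"
    unfolding trace_add met_append s1 ch last append_assoc[symmetric] first ..
  with walk show ?case unfolding len ptree.sel by (rule conjI)
qed

text \<open>The walk begins and ends at \<open>exc G\<close>, whose point is not counted, so the
  optional last entry of \<open>green_subtree\<close> vanishes.\<close>

lemma (in realized) met_vertices_inorder:
  assumes "d" and "ts = [t]"
  shows "map (entering G) (met_vertices G p (edg t)) = inorder t"
proof -
  have "card (edges G) = length (inorder t)"
    using distinct_edges edges_eq assms(2) by (simp add: distinct_card)
  moreover have "map (entering G) (met_vertices G p r) = met G p (trace G (2 * card (edges G)) (exc G, r))" for r
    unfolding met_vertices_def met_def green_sectors_def trace_def by (simp add: comp_def)
  ultimately show ?thesis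
    using green_subtree[OF assms(1) occ_root, of t] assms(2) by simp
qed

section \<open>Drawing a pointed Brauer tree\<close>

text \<open>The list is the orbit of \<open>e\<close> up to its first return. Transitivity
  guarantees a return and makes the orbit exhaust \<open>A\<close>.\<close>

lemma cyc_True_exists:
  assumes bij: "bij_betw f A A" and trans: "\<forall>i\<in>A. \<forall>j\<in>A. \<exists>n. (f ^^ n) i = j" and e: "e \<in> A"
  shows "\<exists>es. cyc True f (e # es) \<and> set (e # es) = A"
proof -
  from bij e obtain k where k: "k \<in> A" "f k = e" by (metis bij_betw_imp_surj_on imageE)
  with trans e obtain n where "(f ^^ n) e = k" by blast
  with k have ex: "Suc n > 0 \<and> (f ^^ Suc n) e = e" by simp
  define m where "m = (LEAST m. m > 0 \<and> (f ^^ m) e = e)"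
  have m: "m > 0" "(f ^^ m) e = e" using LeastI[of "\<lambda>m. m > 0 \<and> (f ^^ m) e = e", OF ex] m_def by auto
  have least: "(f ^^ l) e \<noteq> e" if "0 < l" "l < m" for l
    using not_less_Least[of l "\<lambda>m. m > 0 \<and> (f ^^ m) e = e"] that m_def by auto
  let ?es = "map (\<lambda>n. (f ^^ n) e) [0..<m]"
  have "inj_on (\<lambda>n. (f ^^ n) e) {0..<m}"
  proof (rule linorder_inj_onI)
    fix i j assume ij: "i < j" "i \<in> {0..<m}" "j \<in> {0..<m}"
    show "(f ^^ i) e \<noteq> (f ^^ j) e"
    proof
      assume "(f ^^ i) e = (f ^^ j) e"
      \<comment> \<open>Another \<open>m - j\<close> applications of \<open>f\<close> turn the
        collision into a return to \<open>e\<close> after \<open>m - j + i\<close> steps, a positive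
        number less than \<open>m\<close>.\<close>
      then have "(f ^^ (m - j + i)) e = (f ^^ (m - j + j)) e" unfolding funpow_add by simp
      with ij m least[of "m - j + i"] show False by auto
    qed
  qed auto
  then have dist: "distinct ?es" by (simp add: distinct_map)
  have closed: "(f ^^ n) e \<in> A" for n
    by (induction n) (use e bij bij_betwE in auto)
  have "set ?es = A"
  proof
    show "set ?es \<subseteq> A" using closed by auto
    show "A \<subseteq> set ?es"
    proof
      fix j assume "j \<in> A"
      with trans e obtain n where "(f ^^ n) e = j" by blast
      then have "(f ^^ (n mod m)) e = j" using funpow_mod_eq[OF m(2), of n] by simp
      with m(1) show "j \<in> set ?es" by force
    qed
  qed
  moreover have "?es = e # tl ?es"
    using m(1) by (simp add: upt_conv_Cons)
  moreover have "map f ?es = rotate1 ?es"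
  proof (rule nth_equalityI)
    fix n assume "n < length (map f ?es)"
    then have n: "n < m" by simp
    have "rotate1 ?es ! n = ?es ! (Suc n mod m)"
      using nth_rotate[of n ?es 1] n by simp
    also have "\<dots> = (f ^^ (Suc n mod m)) e" using m(1) by simp
    also have "\<dots> = (f ^^ Suc n) e" using funpow_mod_eq[OF m(2)] .
    finally show "map f ?es ! n = rotate1 ?es ! n" using n by simp
  qed simp
  ultimately show ?thesis using dist unfolding cyc_def by metis
qed

section \<open>Walks and unique paths in a Brauer tree\<close>

lemma walk_append:
  assumes "\<forall>i\<in>edges G. ends G i \<subseteq> verts G"
  shows "walk G u (is @ js) w \<longleftrightarrow> (\<exists>v. walk G u is v \<and> walk G v js w)"
  using assms
proof (induction "is" arbitrary: u)
  case Nil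
  have "u \<in> verts G" if "walk G u js w"
    using that Nil by (cases js) (auto simp: inc_def)
  then show ?case by auto
qed auto

lemma walk_unique: "walk G u is v \<Longrightarrow> walk G u is w \<Longrightarrow> v = w"
  by (induction "is" arbitrary: u) auto

lemma walk_verts_append:
  "walk G u is v \<Longrightarrow> walk_verts G u (is @ js) = walk_verts G u is @ tl (walk_verts G v js)"
proof (induction "is" arbitrary: u)
  case Nil
  then show ?case by (cases js) auto
qed auto

lemma path_through:
  assumes "path G u is v" "w \<in> set (walk_verts G u is)" "\<forall>i\<in>edges G. ends G i \<subseteq> verts G"
  shows "\<exists>js ks. is = js @ ks \<and> path G u js w \<and> path G w ks v"
  using assms(1,2)
proof (induction "is" arbitrary: u)
  case Nil
  then show ?case by (auto simp: path_def)
next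
  case (Cons i "is")
  have u: "u \<in> verts G" using Cons.prems(1) assms(3) by (auto simp: path_def inc_def)
  show ?case
  proof (cases "w = u")
    case True
    then have "path G u [] w \<and> path G w (i # is) v" using u Cons.prems(1) by (simp add: path_def)
    then show ?thesis by (intro exI[of _ "[]"] exI[of _ "i # is"]) simp
  next
    case False
    have "path G (other G i u) is v" using Cons.prems(1) by (simp add: path_def)
    with Cons.IH[OF this] False Cons.prems(2) obtain js ks where
      jk: "is = js @ ks" "path G (other G i u) js w" "path G w ks v" by auto
    then have "walk G u (i # js) w" "distinct (walk_verts G u (i # js))"
      using Cons.prems(1) walk_verts_append[of G "other G i u" js w ks] by (auto simp: path_def)
    with jk show ?thesis by (intro exI[of _ "i # js"] exI[of _ ks]) (simp add: path_def)
  qed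
qed

locale brauer =
  fixes G :: "('v, 'e) brauer_tree"
  assumes is_brauer_tree: "is_brauer_tree G"
begin

lemma ends_verts: "\<forall>i\<in>edges G. ends G i \<subseteq> verts G"
  using is_brauer_tree by (simp add: is_brauer_tree_def)

lemma exc_vert: "exc G \<in> verts G"
  using is_brauer_tree by (simp add: is_brauer_tree_def)

lemma inc_vert: "i \<in> inc G v \<Longrightarrow> v \<in> verts G"
  using ends_verts by (auto simp: inc_def)

lemma ends_other:
  assumes "i \<in> inc G v"
  shows "ends G i = {v, other G i v}" "other G i v \<noteq> v" "other G i (other G i v) = v"
    "i \<in> inc G (other G i v)" "other G i v \<in> verts G"
proof -
  have i: "i \<in> edges G" "v \<in> ends G i" using assms by (auto simp: inc_def)
  then have "card (ends G i) = 2" using is_brauer_tree by (simp add: is_brauer_tree_def)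
  then obtain w where w: "ends G i = {v, w}" "v \<noteq> w" using i(2)
    by (metis card_2_iff doubleton_eq_iff insert_iff singletonD)
  then have "ends G i - {v} = {w}" "ends G i - {w} = {v}" by auto
  then have *: "other G i v = w" "other G i w = v" by (simp_all add: other_def)
  show "ends G i = {v, other G i v}" "other G i v \<noteq> v" "other G i (other G i v) = v"
    "i \<in> inc G (other G i v)" "other G i v \<in> verts G"
    using w * i ends_verts by (auto simp: inc_def)
qed

lemma path_ex1: "u \<in> verts G \<Longrightarrow> v \<in> verts G \<Longrightarrow> \<exists>!is. path G u is v"
  using is_brauer_tree by (simp add: is_brauer_tree_def)

lemma path_path_to: "v \<in> verts G \<Longrightarrow> path G (exc G) (path_to G v) v"
  unfolding path_to_def using theI'[OF path_ex1[OF exc_vert]] .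

lemma path_to_eqI: "path G (exc G) is v \<Longrightarrow> path_to G v = is"
  using path_ex1[OF exc_vert] path_path_to walk_end unfolding path_def by metis

lemma path_to_inj: "v \<in> verts G \<Longrightarrow> w \<in> verts G \<Longrightarrow> path_to G v = path_to G w \<Longrightarrow> v = w"
  using path_path_to walk_unique unfolding path_def by metis

lemma path_to_exc: "path_to G (exc G) = []"
  by (rule path_to_eqI) (simp add: path_def exc_vert)

text \<open>Either the path to \<open>v\<close> extends by \<open>i\<close>, or it already visits
  the other end; then its remainder is a path to \<open>v\<close>, which by uniqueness is
  \<open>[i]\<close>.\<close>

lemma path_to_other:
  assumes "i \<in> inc G v"
  shows "path_to G (other G i v) = path_to G v @ [i] \<or> path_to G v = path_to G (other G i v) @ [i]"
proof -
  let ?w = "other G i v"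
  note v = inc_vert[OF assms] and w = ends_other[OF assms]
  show ?thesis
  proof (cases "?w \<in> set (walk_verts G (exc G) (path_to G v))")
    case False
    then have "path G (exc G) (path_to G v @ [i]) ?w"
      using path_snoc[OF ends_verts] path_path_to[OF v] assms w(5) by blast
    then show ?thesis using path_to_eqI by blast
  next
    case True
    from path_through[OF path_path_to[OF v] True ends_verts] obtain js ks
      where jk: "path_to G v = js @ ks" "path G (exc G) js ?w" "path G ?w ks v" by blast
    have "path G ?w [i] v" using w v by (auto simp: path_def)
    with jk(3) have "ks = [i]" using path_ex1[OF w(5) v] by blast
    with jk path_to_eqI show ?thesis by blast
  qed
qed

lemma path_to_prefix:
  assumes "w \<in> verts G" "path_to G w = path_to G v @ i # is" "v \<in> verts G"
  shows "i \<in> inc G v" "path_to G (other G i v) = path_to G v @ [i]"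
proof -
  from path_path_to[OF assms(1)] have "walk G (exc G) (path_to G v @ i # is) w"
    and dist: "distinct (walk_verts G (exc G) (path_to G v @ i # is))"
    using assms(2) by (simp_all add: path_def)
  then obtain v' where "walk G (exc G) (path_to G v) v'" "walk G v' (i # is) w"
    using walk_append[OF ends_verts] by blast
  moreover have v: "walk G (exc G) (path_to G v) v" using path_path_to[OF assms(3)] by (simp add: path_def)
  ultimately show i: "i \<in> inc G v" using walk_unique by fastforce
  have "walk_verts G (exc G) (path_to G v @ i # is) =
      walk_verts G (exc G) (path_to G v) @ walk_verts G (other G i v) is"
    using walk_verts_append[OF v, of "i # is"] by simp
  moreover have "other G i v \<in> set (walk_verts G (other G i v) is)" by (cases "is") auto
  ultimately have "other G i v \<notin> set (walk_verts G (exc G) (path_to G v))" using dist by auto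
  then have "path G (exc G) (path_to G v @ [i]) (other G i v)"
    using path_snoc[OF ends_verts] path_path_to[OF assms(3)] i ends_other(5)[OF i] by blast
  then show "path_to G (other G i v) = path_to G v @ [i]" by (rule path_to_eqI)
qed

lemma entering_inc:
  assumes "v \<in> verts G" "v \<noteq> exc G"
  shows "entering G v \<in> inc G v" "path_to G v = path_to G (other G (entering G v) v) @ [entering G v]"
proof -
  have "path_to G v \<noteq> []"
    using path_to_inj[OF assms(1) exc_vert] path_to_exc assms(2) by auto
  then have eq: "path_to G v = butlast (path_to G v) @ [entering G v]" by (simp add: entering_def)
  with path_path_to[OF assms(1)] obtain x where x: "path G (exc G) (butlast (path_to G v)) x"
    "entering G v \<in> inc G x" "v = other G (entering G v) x"
    using path_snoc[OF ends_verts] by metis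
  then show "entering G v \<in> inc G v" using ends_other(4) by metis
  have "other G (entering G v) v = x" using x ends_other(3) by metis
  with x(1) path_to_eqI eq show "path_to G v = path_to G (other G (entering G v) v) @ [entering G v]"
    by metis
qed

lemma path_to_child:
  assumes "i \<in> inc G v" "v \<noteq> exc G \<Longrightarrow> i \<noteq> entering G v"
  shows "path_to G (other G i v) = path_to G v @ [i]"
  using path_to_other[OF assms(1)] assms(2) path_to_exc unfolding entering_def
  by (cases "v = exc G") auto

text \<open>Bounds the depth, so that the subtrees can be constructed by induction on the
  complementary depth.\<close>

lemma length_path_to:
  assumes "v \<in> verts G"
  shows "length (path_to G v) < card (verts G)"
proof -
  have "set (walk_verts G u is) \<subseteq> verts G \<and> length (walk_verts G u is) = Suc (length is)"
    if "walk G u is w" for u w "is"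
    using that by (induction "is" arbitrary: u) (use inc_vert in auto)
  from this[of "exc G" "path_to G v" v] path_path_to[OF assms]
  have "set (walk_verts G (exc G) (path_to G v)) \<subseteq> verts G"
    "length (walk_verts G (exc G) (path_to G v)) = Suc (length (path_to G v))"
    "distinct (walk_verts G (exc G) (path_to G v))" by (auto simp: path_def)
  moreover have "finite (verts G)" using is_brauer_tree by (simp add: is_brauer_tree_def)
  ultimately show ?thesis using card_mono distinct_card by (metis Suc_le_eq)
qed

text \<open>Subtrees are assembled from those of the children. Describing their vertices by prefixes
  of \<open>path_to\<close> makes the subtrees of different children disjoint, and the multiset
  equation will give distinct edges through \<open>inj_entering\<close>.\<close>

lemma subtree_exists:
  assumes "is_pointing G p" "v \<in> verts G" "v \<noteq> exc G"
  shows "\<exists>t. vtx t = v \<and> edg t = entering G v \<and> drawn True G p (other G (entering G v) v) t \<and>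
    distinct (vlist t) \<and> set (vlist t) = {w \<in> verts G. \<exists>is. path_to G w = path_to G v @ is} \<and>
    mset (inorder t) = image_mset (entering G) (mset (vlist t))"
  using assms(2,3)
proof (induction "card (verts G) - length (path_to G v)" arbitrary: v rule: less_induct)
  case less
  note v = less.prems
  let ?e = "entering G v" and ?x = "other G (entering G v) v"
  note e = entering_inc[OF v]
  have "bij_betw (nxt G v) (inc G v) (inc G v)"
    "\<forall>i\<in>inc G v. \<forall>j\<in>inc G v. \<exists>n. (nxt G v ^^ n) i = j"
    using is_brauer_tree v by (simp_all add: is_brauer_tree_def)
  from cyc_True_exists[OF this e(1)] obtain es where
    cyc: "cyc True (nxt G v) (?e # es)" and inc: "set (?e # es) = inc G v" by blast
  then have dist: "distinct (?e # es)" by (simp add: cyc_def)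
  obtain j where j: "p v = (j, nxt G v j)" "j \<in> set (?e # es)"
    using assms(1) v inc by (auto simp: is_pointing_def sectors_def)
  \<comment> \<open>The children are cut after the first edge \<open>j\<close> of the pointed
    sector; if \<open>j\<close> is the entering edge, the left part is empty.\<close>
  have "\<exists>as bs. es = as @ bs \<and> last (?e # as) = j"
  proof (cases "j = ?e")
    case False
    with j(2) obtain as bs where "es = as @ j # bs" by (metis set_ConsD split_list)
    then show ?thesis by (intro exI[of _ "as @ [j]"] exI[of _ bs]) simp
  qed (auto intro: exI[of _ "[]"])
  then obtain as bs where ab: "es = as @ bs" "last (?e # as) = j" by blast
  have p: "p v = (last (?e # as), hd (bs @ [?e]))"
    using j(1) ab cyc_True_last[of "nxt G v" ?e as bs] cyc by simp
  have child: "i \<in> inc G v" "path_to G (other G i v) = path_to G v @ [i]" if "i \<in> set es" for i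
    using that inc dist path_to_child[of i v] by auto
  let ?P = "\<lambda>i t. vtx t = other G i v \<and> edg t = i \<and> drawn True G p v t \<and>
    distinct (vlist t) \<and> set (vlist t) = {w \<in> verts G. \<exists>is. path_to G w = path_to G v @ i # is} \<and>
    mset (inorder t) = image_mset (entering G) (mset (vlist t))"
  have "\<exists>t. ?P i t" if i: "i \<in> set es" for i
  proof -
    let ?w = "other G i v"
    have w: "?w \<in> verts G" "other G i ?w = v" using ends_other child(1)[OF i] by simp_all
    moreover have "?w \<noteq> exc G" using child(2)[OF i] path_to_exc by auto
    moreover have "entering G ?w = i" using child(2)[OF i] by (simp add: entering_def)
    moreover have "card (verts G) - length (path_to G ?w) < card (verts G) - length (path_to G v)"
      using child(2)[OF i] length_path_to[OF v(1)] by simp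
    ultimately show ?thesis using less.hyps[of ?w] child(2)[OF i] by simp
  qed
  then have "\<forall>i\<in>set es. \<exists>t. ?P i t" by (rule ballI)
  from bchoice[OF this] obtain T where "\<forall>i\<in>set es. ?P i (T i)" ..
  then have T: "?P i (T i)" if "i \<in> set es" for i using that by (rule bspec)
  let ?t = "Node v ?e (map T as) (map T bs)"
  have edgT: "map edg (map T cs) = cs" if "set cs \<subseteq> set es" for cs
    using that T by (simp add: map_idI subset_iff)
  have "drawn True G p ?x ?t"
  proof -
    have "ends G ?e = {?x, v}" using ends_other(1)[OF e(1)] by auto
    moreover have "\<forall>t\<in>set (map T as @ map T bs). drawn True G p v t" using T ab(1) by auto
    moreover have "map edg (map T as @ map T bs) = es" using edgT ab(1) by simp
    moreover have "map edg (map T as) = as" "map edg (map T bs) = bs" using edgT ab(1) by simp_all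
    ultimately show ?thesis using cyc p by (simp del: map_map map_append add: orient_def)
  qed
  have vl: "vlist ?t = v # concat (map (vlist \<circ> T) es)" using ab(1) by simp
  have mem: "w \<in> set (vlist (T i)) \<longleftrightarrow> w \<in> verts G \<and> (\<exists>is. path_to G w = path_to G v @ i # is)"
    if "i \<in> set es" for w i using T[OF that] by auto
  have "set (vlist ?t) = {w \<in> verts G. \<exists>is. path_to G w = path_to G v @ is}"
  proof (intro equalityI subsetI)
    fix w assume "w \<in> set (vlist ?t)"
    then show "w \<in> {w \<in> verts G. \<exists>is. path_to G w = path_to G v @ is}"
      unfolding vl using v mem by auto
  next
    fix w assume "w \<in> {w \<in> verts G. \<exists>is. path_to G w = path_to G v @ is}"
    then obtain "is" where w: "w \<in> verts G" "path_to G w = path_to G v @ is" by blast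
    show "w \<in> set (vlist ?t)"
    proof (cases "is")
      case Nil
      with w path_to_inj v have "w = v" by simp
      then show ?thesis by simp
    next
      case (Cons i js)
      note i = path_to_prefix[OF w(1) w(2)[unfolded Cons] v(1)]
      have "i \<noteq> ?e" using i(2) e(2) by auto
      with i inc have "i \<in> set es" by auto
      with mem w Cons have "w \<in> set (vlist (T i))" by blast
      with \<open>i \<in> set es\<close> show ?thesis unfolding vl by auto
    qed
  qed
  moreover have "distinct (vlist ?t)"
  proof -
    have "distinct (concat (map (vlist \<circ> T) cs))" if "distinct cs" "set cs \<subseteq> set es" for cs
      using that
    proof (induction cs)
      case (Cons i cs)
      have "set (vlist (T i)) \<inter> set (vlist (T k)) = {}" if "k \<in> set cs" for k
      proof -
        have "i \<in> set es" "k \<in> set es" "i \<noteq> k" using that Cons.prems by auto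
        then show ?thesis using mem by auto
      qed
      with Cons T show ?case by auto
    qed simp
    then have "distinct (concat (map (vlist \<circ> T) es))" using dist by simp
    moreover have "v \<notin> set (vlist (T i))" if "i \<in> set es" for i using mem[OF that] by auto
    ultimately show ?thesis unfolding vl by auto
  qed
  moreover have "mset (inorder ?t) = image_mset (entering G) (mset (vlist ?t))"
  proof -
    have "mset (concat (map (inorder \<circ> T) es)) = mset (concat (map (map (entering G) \<circ> vlist \<circ> T) es))"
      by (rule mset_concat_map_cong) (use T in simp)
    moreover have "mset (inorder ?t) = add_mset ?e (mset (concat (map (inorder \<circ> T) es)))"
      using ab(1) by simp
    ultimately show ?thesis unfolding vl by (simp add: map_concat comp_def flip: mset_map)
  qed
  ultimately show ?case using \<open>drawn True G p ?x ?t\<close> by (intro exI[of _ ?t]) simp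
qed

text \<open>Two vertices with the same entering edge would be its two ends, and the path to each
  would be longer by one than the path to the other.\<close>

lemma inj_entering: "inj_on (entering G) (verts G - {exc G})"
proof (rule inj_onI, rule ccontr)
  fix v w assume vw: "v \<in> verts G - {exc G}" "w \<in> verts G - {exc G}" "entering G v = entering G w" "v \<noteq> w"
  then have e: "entering G w \<in> inc G v" "entering G w \<in> inc G w"
    and pv: "path_to G v = path_to G (other G (entering G w) v) @ [entering G w]"
    and pw: "path_to G w = path_to G (other G (entering G w) w) @ [entering G w]"
    using entering_inc[of v] entering_inc[of w] by auto
  from ends_other(1)[OF e(1)] e(2) vw(4) have "other G (entering G w) v = w" by (auto simp: inc_def)
  moreover from this ends_other(3)[OF e(1)] have "other G (entering G w) w = v" by simp
  ultimately show False using arg_cong[OF pv, of length] arg_cong[OF pw, of length] by simp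
qed

lemma edges_entering: "edges G = entering G ` (verts G - {exc G})"
proof (intro equalityI subsetI)
  fix i assume i: "i \<in> edges G"
  then have "card (ends G i) = 2" using is_brauer_tree by (simp add: is_brauer_tree_def)
  then obtain v where "v \<in> ends G i" by fastforce
  with i have inc: "i \<in> inc G v" by (simp add: inc_def)
  have *: "i \<in> entering G ` (verts G - {exc G})"
    if "path_to G w = js @ [i]" "w \<in> verts G" for w js
    using that path_to_exc by (force simp: entering_def)
  from path_to_other[OF inc] * inc_vert[OF inc] ends_other(5)[OF inc]
  show "i \<in> entering G ` (verts G - {exc G})" by blast
next
  fix i assume "i \<in> entering G ` (verts G - {exc G})"
  then show "i \<in> edges G" using entering_inc(1) by (auto simp: inc_def)
qed

lemma realized_exists:
  assumes "is_pointing G p" "inc G (exc G) = {r}"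
  shows "\<exists>t. realized True G p [t] \<and> edg t = r"
proof -
  let ?w = "other G r (exc G)"
  have r: "r \<in> inc G (exc G)" using assms(2) by simp
  note w = ends_other[OF r]
  have pw: "path_to G ?w = [r]" using path_to_child[OF r] path_to_exc by simp
  then have ent: "entering G ?w = r" by (simp add: entering_def)
  from subtree_exists[OF assms(1) w(5,2)] obtain t where t: "vtx t = ?w" "edg t = r"
    "drawn True G p (exc G) t" "distinct (vlist t)"
    "set (vlist t) = {v \<in> verts G. \<exists>is. path_to G v = r # is}"
    "mset (inorder t) = image_mset (entering G) (mset (vlist t))"
    unfolding ent w(3) pw by auto
  have vs: "set (vlist t) = verts G - {exc G}"
  proof (intro equalityI subsetI)
    fix v assume "v \<in> set (vlist t)"
    with t(5) path_to_exc show "v \<in> verts G - {exc G}" by auto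
  next
    fix v assume v: "v \<in> verts G - {exc G}"
    then have "path_to G v \<noteq> []" using path_to_inj[OF _ exc_vert] path_to_exc by auto
    then obtain i "is" where i: "path_to G v = i # is" by (cases "path_to G v") auto
    then have "i \<in> inc G (exc G)" using path_to_prefix(1)[of v "exc G"] v path_to_exc exc_vert by simp
    with assms(2) i v t(5) show "v \<in> set (vlist t)" by auto
  qed
  have io: "mset (inorder t) = mset (map (entering G) (vlist t))" using t(6) by simp
  have "realized True G p [t]"
  proof
    show "verts G = insert (exc G) (set (concat (map vlist [t])))" using vs exc_vert by auto
    show "edges G = set (concat (map inorder [t]))"
      using mset_eq_setD[OF io] edges_entering vs by simp
    show "distinct (exc G # concat (map vlist [t]))" using t(4) vs by simp
    show "distinct (concat (map inorder [t]))"
      using mset_eq_imp_distinct_iff[OF io] t(4) inj_entering vs by (simp add: distinct_map)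
    show "\<forall>t\<in>set [t]. drawn True G p (exc G) t" using t(3) by simp
    have "bij_betw (nxt G (exc G)) {r} {r}"
      using is_brauer_tree exc_vert assms(2) by (auto simp: is_brauer_tree_def)
    then show "cyc True (nxt G (exc G)) (map edg [t])" using t(2) by (auto simp: cyc_def bij_betw_def)
  qed
  with t(2) show ?thesis by blast
qed

end

theorem lemma4p1:
  fixes G :: "('v, 'e) brauer_tree" and p :: "('v, 'e) pointing"
    and num :: "'e \<Rightarrow> int" and a b c :: int and r :: 'e
  assumes "is_brauer_tree G" and "is_pointing G p"
    and "inc G (exc G) = {r}"
    and "pointed_numbering G p r a b num"
    and "num r = c" and "a \<le> c" and "c \<le> b"
  shows "(\<exists>\<sigma>. kozakai_permutation G p a b num \<sigma>) \<and>
    (\<forall>\<sigma>. kozakai_permutation G p a b num \<sigma> \<longrightarrow>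
      (\<exists>\<pi>\<^sub>L \<pi>\<^sub>R. \<pi>\<^sub>L permutes {a..c - 1} \<and> \<pi>\<^sub>R permutes {c + 1..b} \<and> \<sigma> = \<pi>\<^sub>L \<circ> \<pi>\<^sub>R))"
proof -
  interpret brauer G by unfold_locales fact
  obtain t where realized: "realized True G p [t]" and t: "edg t = r"
    using realized_exists[OF assms(2,3)] by blast
  interpret r: realized True G p "[t]" by fact
  have num: "map num (inorder t) = [a..b]"
    using assms(4) r.met_vertices_inorder[of t] t by (simp add: pointed_numbering_def del: map_map)
  have "i \<in> branch G r" if "i \<in> edges G" for i
  proof -
    from r.edgeE[OF that] obtain x s where s: "(x, s) \<in> r.occ" "edg s = i" .
    then have "(x, s) \<in> set (nlist (exc G) t)" by (simp add: forest_nodes_def)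
    from r.hd_path_to[OF this] r.far_end_edg[OF s(1)] s(2) t that show ?thesis
      by (simp add: branch_def)
  qed
  then have branch: "branch G r = edges G" by (auto simp: branch_def)
  let ?s = "\<lparr>tree = G, point = p, initial = branch G r, current = r, start = r\<rparr>"
  have state: "run_state r (sides r (inorder t)) (edges G) ?s [t]"
    using realized t by (simp add: run_state_def branch)
  have start: "kozakai_start G p s \<longleftrightarrow> s = ?s" for s
  proof -
    \<comment> \<open>If the only branch is a leaf, the tree is a star. So \<open>r\<close> is
      admissible in either case, and the starting state is unique.\<close>
    have "\<not> leaf_branch G r \<or> is_star G"
      using r.leaf_branch_root[of "vtx t" r "lefts t" "rights t"] r.is_star_leaves t
      by (metis list.set_intros(1) ptree.collapse set_ConsD empty_iff list.set(1))
    then show ?thesis by (simp add: kozakai_start_def assms(3))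
  qed
  have perm: "kozakai_permutation G p a b num \<sigma> \<longleftrightarrow>
      (\<exists>u. kozakai_step\<^sup>*\<^sup>* ?s u \<and> is_star (tree u) \<and>
        \<sigma> = (\<lambda>i. if i \<in> {a..b} then num (reading u ! nat (i - a)) else i))" for \<sigma>
    unfolding kozakai_permutation_def start fun_eq_iff by simp
  show ?thesis
  proof (intro conjI allI impI)
    show "\<exists>\<sigma>. kozakai_permutation G p a b num \<sigma>"
      unfolding perm using run_state_terminates[OF state] by fast
  next
    fix \<sigma> assume "kozakai_permutation G p a b num \<sigma>"
    then obtain u where u: "kozakai_step\<^sup>*\<^sup>* ?s u" "is_star (tree u)"
      and \<sigma>: "\<sigma> = (\<lambda>i. if i \<in> {a..b} then num (reading u ! nat (i - a)) else i)"
      unfolding perm by (elim exE conjE)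
    from run_state_steps[OF u(1) state] obtain us
      where us: "run_state r (sides r (inorder t)) (edges G) u us" by blast
    interpret u: realized True "tree u" "point u" us using us by (simp add: run_state_def)
    note reading = run_state_reading[OF us u(2)]
    have "distinct (reading u)" using u.distinct_edges unfolding reading .
    moreover have "set (reading u) = set (inorder t)"
      using u.edges_eq r.edges_eq us unfolding reading run_state_def by simp
    moreover have "r \<in> set (inorder t)" using edg_inorder[of t] t by simp
    moreover have "sides r (reading u) = sides r (inorder t)"
      using us unfolding reading run_state_def by simp
    ultimately show "\<exists>\<pi>\<^sub>L \<pi>\<^sub>R. \<pi>\<^sub>L permutes {a..c - 1} \<and> \<pi>\<^sub>R permutes {c + 1..b} \<and> \<sigma> = \<pi>\<^sub>L \<circ> \<pi>\<^sub>R"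
      unfolding \<sigma> by (intro permutation_splits[OF num _ _ _ assms(5)])
  qed
qed


end
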